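(* Let $I\subseteq\mathbb{R}_+$, let $(f,g)\in\mathscr{C}_3(I)$, let $m\in\mathscr{C}_3(I^d\times T)$ be a homogeneous measurable family of means, and let $\mu$ be a probability measure on the measurable space $(T,\mathscr{A})$. Assume that there exists a point $x_0\in I$ such that $$\mu\Big(\big\{t\in T\mid \partial_1^*m(x_0^{(d)},t)=\cdots=\partial_d^*m(x_0^{(d)},t)=0\big\}\Big)<1$$ and there exist $i,j,l\in\{1,\dots,d\}$ such that $$\big\langle\partial_i^*m\,\partial_j^*m\,\partial_l^*m\big\rangle_\mu\big(x_0^{(d)}\big)\neq0.$$ Then the following assertions are equivalent: (i) $M_{f,g,m;\mu}$ is homogeneous; (ii) For all $\lambda\in I/I$ and for all $\boldsymbol{x}\in I_\lambda^d$, $M_{f,g,m;\mu}(\boldsymbol{x})=M_{f_\lambda,g_\lambda,m;\mu}(\boldsymbol{x})$; (iii) For all $\lambda\in I/I$, the pairs $(f,g)$ and $(f_\lambda,g_\lambda)$ are equivalent on the interval $I_\lambda$; (iv) For all $\lambda\in I/I$ and for all $x\in I_\lambda$, $\Phi_{f,g}(x)=\Phi_{f_\lambda,g_\lambda}(x)$ and $\Psi_{f,g}(x)=\Psi_{f_\lambda,g_\lambda}(x)$; (v) There exist two real numbers $\alpha,\beta$ such that $y=f$ and $y=g$ are solutions of the second-order linear differential equation $y''(x)=\frac{\alpha}{x}y'(x)+\frac{\beta}{x^2}y(x)$ $(x\in I)$; (vi) There exists a pair $(p,q)\in\{(z,w)\in\mathbb{C}^2\mid z+w,\,zw\in\mathbb{R}\}$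 such that $M_{f,g,m;\mu}$ is equal to the $d$-variable generalized Gini mean $G_{p,q,m;\mu}$.
   Context: $\mathbb{R}_+$ is the set of positive reals, $I$ is a nonempty open interval contained in $\mathbb{R}_+$, $d$ is a positive integer, $(T,\mathscr{A})$ is a measurable space. A function $M:I^d\to I$ is a $d$-variable mean on $I$ if $\min(x_1,\dots,x_d)\le M(\boldsymbol{x})\le\max(x_1,\dots,x_d)$ for all $\boldsymbol{x}\in I^d$. A measurable family of $d$-variable means is a map $m:I^d\times T\to I$ such that $m(\cdot,t)$ is a $d$-variable mean on $I$ for each $t\in T$ and $m(\boldsymbol{x},\cdot)$ is measurable for each $\boldsymbol{x}\in I^d$. Put $I/I:=\{x/y\mid x,y\in I\}$ and, for $\lambda>0$, $I_\lambda:=I\cap\frac1\lambda I$, where $cI:=\{cx\mid x\in I\}$ ($I_\lambda$ is nonempty iff $\lambda\in I/I$). A mean $M$ on $I$ is homogeneous if $M(\lambda\boldsymbol{x})=\lambda M(\boldsymbol{x})$ for all $\lambda\in I/I$ and $\boldsymbol{x}\in I_\lambda^d$; the family $m$ is homogeneous if $m(\cdot,t)$ is homogeneous for every $t\in T$. For $f:I\to\mathbb{R}$ and $\lambda>0$, $f_\lambda:\frac1\lambda I\to\mathbb{R}$ is $f_\lambda(x):=f(\lambda x)$. For $f,g$ real-valued put $\mathscr{D}_{f,g}(x,y):=f(x)g(y)-f(y)g(x)$. A pair $(f,g)$ of continuous functions is a Chebyshev system on an interval if $\mathscr{D}_{f,g}(x,y)\ne0$ for all distinct $x,y$ in it. For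 $n\ge1$, $\mathscr{C}_n(I)$ is the class of pairs $(f,g)$ of $n$-times continuously differentiable real functions on $I$ that form a Chebyshev system on $I$ and whose Wronskian $f'g-fg'$ does not vanish on $I$. For $(f,g)\in\mathscr{C}_2(I)$, $$\Phi_{f,g}:=\frac{f''g-fg''}{f'g-fg'},\qquad \Psi_{f,g}:=-\frac{f''g'-f'g''}{f'g-fg'}.$$ Pairs $(f,g)$ and $(h,k)$ are equivalent on an interval if there are $\alpha,\beta,\gamma,\delta\in\mathbb{R}$ with $\alpha\delta-\beta\gamma\ne0$, $f=\alpha h+\beta k$ and $g=\gamma h+\delta k$ on that interval. For a Chebyshev system $(f,g)$, a measurable family $m$ and a probability measure $\mu$ on $(T,\mathscr{A})$, $M_{f,g,m;\mu}(\boldsymbol{x})$ is the unique $y$ in the interval with $\int_T\mathscr{D}_{f,g}(m(\boldsymbol{x},t),y)\,d\mu(t)=0$ (existence and uniqueness of $y$ are known). If $g>0$ and $f/g$ is strictly monotone, then $M_{f,g,m;\mu}(\boldsymbol{x})=\left(\frac fg\right)^{-1}\left(\frac{\int_T f(m(\boldsymbol{x},t))\,d\mu(t)}{\int_T g(m(\boldsymbol{x},t))\,d\mu(t)}\right)$. On $I_\lambda^d$, $M_{f_\lambda,g_\lambda,m;\mu}$ is formed with the restrictions of $f_\lambda,g_\lambda$ to $I_\lambda$ and of $m$ to $I_\lambda^d\times T$. Generalized Gini means: let $p,q\in\mathbb{C}$ with $p+q,pq\in\mathbb{R}$ (i.e. $p,q\in\mathbb{R}$ or $p=\bar q$). $G_{p,q,m;\mu}$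 is the mean $M_{f,g,m;\mu}$ with generators: $f(x)=x^p$, $g(x)=x^q$ if $p,q\in\mathbb{R}$, $p\ne q$; $f(x)=x^p\log x$, $g(x)=x^p$ if $p=q\in\mathbb{R}$; $f(x)=x^a\sin(b\log x)$, $g(x)=x^a\cos(b\log x)$ if $p=\bar q=a+bi$ with $a,b\in\mathbb{R}$, $b\neq0$. In the last case $(f,g)$ is a Chebyshev system on $I$ (so that $G_{p,q,m;\mu}$ is defined on $I^d$) if and only if $I/I\subseteq(\exp(-\pi/|b|),\exp(\pi/|b|))$. A function $\varphi:I^d\times T\to\mathbb{R}$ is of $L^q$-type ($q\ge1$) at $\boldsymbol{p}\in I^d$ if $\varphi(\boldsymbol{p},\cdot)$ is measurable and there exist $\delta>0$ and a measurable $a:T\to\mathbb{R}$ with $|a|^q$ $\mu$-integrable such that $|\varphi(\boldsymbol{x},t)|\le a(t)$ for all $t\in T$ and all $\boldsymbol{x}\in I^d$ with $|\boldsymbol{x}-\boldsymbol{p}|\le\delta$. $\mathscr{C}_1(I^d\times T)$ is the class of measurable families $m$ of $d$-variable means such that each $m(\cdot,t)$ is continuously partially differentiable on $I^d$ and each $\partial_i m$ is of $L^1$-type at every $\boldsymbol{p}\in I^d$. $\mathscr{C}_2(I^d\times T)$ consists of those $m\in\mathscr{C}_1(I^d\times T)$ such that each $m(\cdot,t)$ is twice continuously partially differentiable and, at every $\boldsymbol{p}$ and for all $i,j$, $\partial_i m$ is of $L^2$-type and $\partial_i\partial_j m$ of $L^1$-type. $\mathscr{C}_3(I^d\times T)$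 consists of those $m\in\mathscr{C}_2(I^d\times T)$ such that each $m(\cdot,t)$ is three times continuously partially differentiable and, at every $\boldsymbol{p}$ and for all $i,j,l$, $\partial_i m$ is of $L^3$-type, $\partial_i\partial_j m$ of $L^{3/2}$-type and $\partial_i\partial_j\partial_l m$ of $L^1$-type. Notation: $\langle\varphi\rangle_\mu(\boldsymbol{x}):=\int_T\varphi(\boldsymbol{x},t)\,d\mu(t)$; $\partial_r^*m(\boldsymbol{x},t):=\partial_r m(\boldsymbol{x},t)-\langle\partial_r m\rangle_\mu(\boldsymbol{x})$; $x^{(d)}:=(x,\dots,x)\in I^d$ for $x\in I$. *)

theory Defs
  imports "HOL-Probability.Probability"
begin

text \<open>
  Points of \<open>I\<^sup>d\<close> are vectors of type \<^typ>\<open>real ^ 'n\<close> with all components in \<open>I\<close>, and \<open>d = CARD('n)\<close>.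
  The measurable space \<open>(T, \<A>)\<close> consists of \<^term>\<open>space \<mu>\<close> and \<^term>\<open>sets \<mu>\<close> for a measure \<open>\<mu>\<close>.
  Functions given on \<open>I\<close>, \<open>I\<^sup>d\<close> or \<open>I\<^sup>d \<times> T\<close> are represented by total functions whose values
  elsewhere are irrelevant: every notion below only uses the values on these (open) domains.
\<close>

definition cube :: "real set \<Rightarrow> (real ^ 'n) set"
  where "cube I = {x. \<forall>i. x $ i \<in> I}"

definition ratio_set :: "real set \<Rightarrow> real set"
  where "ratio_set I = {x / y | x y. x \<in> I \<and> y \<in> I}"

definition scaled_inter :: "real set \<Rightarrow> real \<Rightarrow> real set"
  where "scaled_inter I c = I \<inter> (\<lambda>x. (1 / c) * x) ` I"

definition rescale :: "real \<Rightarrow> (real \<Rightarrow> real) \<Rightarrow> real \<Rightarrow> real"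
  where "rescale c f = (\<lambda>x. f (c * x))"


subsection \<open>Means\<close>

definition mean_on :: "real set \<Rightarrow> (real ^ 'n \<Rightarrow> real) \<Rightarrow> bool"
  where "mean_on I M \<longleftrightarrow>
    (\<forall>x \<in> cube I. M x \<in> I \<and> Min (range (\<lambda>i. x $ i)) \<le> M x \<and> M x \<le> Max (range (\<lambda>i. x $ i)))"

definition homogeneous_on :: "real set \<Rightarrow> (real ^ 'n \<Rightarrow> real) \<Rightarrow> bool"
  where "homogeneous_on I M \<longleftrightarrow>
    (\<forall>c \<in> ratio_set I. \<forall>x \<in> cube (scaled_inter I c). M (c *\<^sub>R x) = c * M x)"

definition measurable_family_of_means ::
    "real set \<Rightarrow> 't measure \<Rightarrow> (real ^ 'n \<Rightarrow> 't \<Rightarrow> real) \<Rightarrow> bool"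
  where "measurable_family_of_means I \<mu> m \<longleftrightarrow>
    (\<forall>t \<in> space \<mu>. mean_on I (\<lambda>x. m x t)) \<and> (\<forall>x \<in> cube I. m x \<in> borel_measurable \<mu>)"

definition homogeneous_family ::
    "real set \<Rightarrow> 't measure \<Rightarrow> (real ^ 'n \<Rightarrow> 't \<Rightarrow> real) \<Rightarrow> bool"
  where "homogeneous_family I \<mu> m \<longleftrightarrow> (\<forall>t \<in> space \<mu>. homogeneous_on I (\<lambda>x. m x t))"


subsection \<open>Chebyshev systems\<close>

definition cheb_det :: "(real \<Rightarrow> real) \<Rightarrow> (real \<Rightarrow> real) \<Rightarrow> real \<Rightarrow> real \<Rightarrow> real"
  where "cheb_det f g x y = f x * g y - f y * g x"

definition chebyshev_system :: "real set \<Rightarrow> (real \<Rightarrow> real) \<Rightarrow> (real \<Rightarrow> real) \<Rightarrow> bool"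
  where "chebyshev_system J f g \<longleftrightarrow>
    continuous_on J f \<and> continuous_on J g \<and>
    (\<forall>x \<in> J. \<forall>y \<in> J. x \<noteq> y \<longrightarrow> cheb_det f g x y \<noteq> 0)"

definition cont_diff_on :: "nat \<Rightarrow> real set \<Rightarrow> (real \<Rightarrow> real) \<Rightarrow> bool"
  where "cont_diff_on n I f \<longleftrightarrow>
    (\<forall>k < n. \<forall>x \<in> I. (deriv ^^ k) f differentiable (at x)) \<and> continuous_on I ((deriv ^^ n) f)"

definition wronskian :: "(real \<Rightarrow> real) \<Rightarrow> (real \<Rightarrow> real) \<Rightarrow> real \<Rightarrow> real"
  where "wronskian f g x = deriv f x * g x - f x * deriv g x"

definition smooth_chebyshev :: "nat \<Rightarrow> real set \<Rightarrow> (real \<Rightarrow> real) \<Rightarrow> (real \<Rightarrow> real) \<Rightarrow> bool"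
  where "smooth_chebyshev n I f g \<longleftrightarrow>
    cont_diff_on n I f \<and> cont_diff_on n I g \<and> chebyshev_system I f g \<and>
    (\<forall>x \<in> I. wronskian f g x \<noteq> 0)"

definition Phi :: "(real \<Rightarrow> real) \<Rightarrow> (real \<Rightarrow> real) \<Rightarrow> real \<Rightarrow> real"
  where "Phi f g x = (deriv (deriv f) x * g x - f x * deriv (deriv g) x) / wronskian f g x"

definition Psi :: "(real \<Rightarrow> real) \<Rightarrow> (real \<Rightarrow> real) \<Rightarrow> real \<Rightarrow> real"
  where "Psi f g x =
    - ((deriv (deriv f) x * deriv g x - deriv f x * deriv (deriv g) x) / wronskian f g x)"

definition equivalent_pairs ::
    "real set \<Rightarrow> (real \<Rightarrow> real) \<times> (real \<Rightarrow> real) \<Rightarrow> (real \<Rightarrow> real) \<times> (real \<Rightarrow> real) \<Rightarrow> bool"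
  where "equivalent_pairs J = (\<lambda>(f, g) (h, k).
    \<exists>\<alpha> \<beta> \<gamma> \<delta> :: real. \<alpha> * \<delta> - \<beta> * \<gamma> \<noteq> 0 \<and>
      (\<forall>x \<in> J. f x = \<alpha> * h x + \<beta> * k x \<and> g x = \<gamma> * h x + \<delta> * k x))"


subsection \<open>Generalized quasiarithmetic means and generalized Gini means\<close>

text \<open>
  The interval \<open>J\<close> is a parameter, since the means are formed on \<open>I\<close> as well as on \<^term>\<open>scaled_inter I c\<close>.
  The description is meaningful only if \<open>(f, g)\<close> is a Chebyshev system on the open interval \<open>J\<close>.
\<close>

definition gen_mean ::
    "real set \<Rightarrow> (real \<Rightarrow> real) \<Rightarrow> (real \<Rightarrow> real) \<Rightarrow> (real ^ 'n \<Rightarrow> 't \<Rightarrow> real) \<Rightarrow> 't measure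
      \<Rightarrow> real ^ 'n \<Rightarrow> real"
  where "gen_mean J f g m \<mu> x = (THE y. y \<in> J \<and> (\<integral>t. cheb_det f g (m x t) y \<partial>\<mu>) = 0)"

text \<open>
  If \<open>p + q\<close> and \<open>p * q\<close> are real and not both of \<open>p\<close>, \<open>q\<close> are real, then \<open>p = cnj q\<close> with
  \<^prop>\<open>Im p \<noteq> 0\<close>; this is the last case of the following two definitions.
\<close>

definition gini_f :: "complex \<Rightarrow> complex \<Rightarrow> real \<Rightarrow> real"
  where "gini_f p q x =
    (if p \<in> \<real> \<and> q \<in> \<real> then
       (if p \<noteq> q then x powr Re p else x powr Re p * ln x)
     else x powr Re p * sin (Im p * ln x))"

definition gini_g :: "complex \<Rightarrow> complex \<Rightarrow> real \<Rightarrow> real"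
  where "gini_g p q x =
    (if p \<in> \<real> \<and> q \<in> \<real> then
       (if p \<noteq> q then x powr Re q else x powr Re p)
     else x powr Re p * cos (Im p * ln x))"

definition gini_mean ::
    "real set \<Rightarrow> complex \<Rightarrow> complex \<Rightarrow> (real ^ 'n \<Rightarrow> 't \<Rightarrow> real) \<Rightarrow> 't measure \<Rightarrow> real ^ 'n \<Rightarrow> real"
  where "gini_mean I p q m \<mu> = gen_mean I (gini_f p q) (gini_g p q) m \<mu>"

text \<open>
  For nonreal \<open>p\<close>, \<open>q\<close> the generators need not form a Chebyshev system on \<open>I\<close>, in which case the
  Gini mean is not defined on \<open>I\<^sup>d\<close>.
\<close>

definition gini_mean_defined :: "real set \<Rightarrow> complex \<Rightarrow> complex \<Rightarrow> bool"
  where "gini_mean_defined I p q \<longleftrightarrow> chebyshev_system I (gini_f p q) (gini_g p q)"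


subsection \<open>Partial derivatives and smoothness classes of families of means\<close>

definition partial_deriv :: "'n::finite \<Rightarrow> (real ^ 'n \<Rightarrow> real) \<Rightarrow> real ^ 'n \<Rightarrow> real"
  where "partial_deriv i \<phi> x = deriv (\<lambda>s. \<phi> (x + s *\<^sub>R axis i 1)) 0"

definition has_partial_deriv :: "'n::finite \<Rightarrow> (real ^ 'n \<Rightarrow> real) \<Rightarrow> real ^ 'n \<Rightarrow> bool"
  where "has_partial_deriv i \<phi> x \<longleftrightarrow> (\<lambda>s. \<phi> (x + s *\<^sub>R axis i 1)) differentiable (at 0)"

text \<open>The list \<open>[i, j, l]\<close> stands for the iterated partial derivative \<open>\<partial>\<^sub>i \<partial>\<^sub>j \<partial>\<^sub>l\<close>.\<close>

definition partial_derivs :: "'n::finite list \<Rightarrow> (real ^ 'n \<Rightarrow> real) \<Rightarrow> real ^ 'n \<Rightarrow> real"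
  where "partial_derivs is = foldr partial_deriv is"

definition cont_partial_diff_on :: "nat \<Rightarrow> (real ^ 'n) set \<Rightarrow> (real ^ 'n::finite \<Rightarrow> real) \<Rightarrow> bool"
  where "cont_partial_diff_on n U \<phi> \<longleftrightarrow>
    (\<forall>is. length is < n \<longrightarrow> (\<forall>i. \<forall>x \<in> U. has_partial_deriv i (partial_derivs is \<phi>) x)) \<and>
    (\<forall>is. length is \<le> n \<longrightarrow> continuous_on U (partial_derivs is \<phi>))"

text \<open>Partial derivatives of a family, with respect to its vector argument.\<close>

definition fam_partial ::
    "'n::finite list \<Rightarrow> (real ^ 'n \<Rightarrow> 't \<Rightarrow> real) \<Rightarrow> real ^ 'n \<Rightarrow> 't \<Rightarrow> real"
  where "fam_partial is m x t = partial_derivs is (\<lambda>y. m y t) x"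

definition Lq_type_at ::
    "real \<Rightarrow> real set \<Rightarrow> 't measure \<Rightarrow> (real ^ 'n \<Rightarrow> 't \<Rightarrow> real) \<Rightarrow> real ^ 'n \<Rightarrow> bool"
  where "Lq_type_at q I \<mu> \<phi> p \<longleftrightarrow>
    \<phi> p \<in> borel_measurable \<mu> \<and>
    (\<exists>\<delta> > 0. \<exists>a. a \<in> borel_measurable \<mu> \<and> integrable \<mu> (\<lambda>t. \<bar>a t\<bar> powr q) \<and>
      (\<forall>t \<in> space \<mu>. \<forall>x \<in> cube I. norm (x - p) \<le> \<delta> \<longrightarrow> \<bar>\<phi> x t\<bar> \<le> a t))"

definition C1_family :: "real set \<Rightarrow> 't measure \<Rightarrow> (real ^ 'n::finite \<Rightarrow> 't \<Rightarrow> real) \<Rightarrow> bool"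
  where "C1_family I \<mu> m \<longleftrightarrow>
    measurable_family_of_means I \<mu> m \<and>
    (\<forall>t \<in> space \<mu>. cont_partial_diff_on 1 (cube I) (\<lambda>x. m x t)) \<and>
    (\<forall>p \<in> cube I. \<forall>i. Lq_type_at 1 I \<mu> (fam_partial [i] m) p)"

definition C2_family :: "real set \<Rightarrow> 't measure \<Rightarrow> (real ^ 'n::finite \<Rightarrow> 't \<Rightarrow> real) \<Rightarrow> bool"
  where "C2_family I \<mu> m \<longleftrightarrow>
    C1_family I \<mu> m \<and>
    (\<forall>t \<in> space \<mu>. cont_partial_diff_on 2 (cube I) (\<lambda>x. m x t)) \<and>
    (\<forall>p \<in> cube I. \<forall>i j.
      Lq_type_at 2 I \<mu> (fam_partial [i] m) p \<and>
      Lq_type_at 1 I \<mu> (fam_partial [i, j] m) p)"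

definition C3_family :: "real set \<Rightarrow> 't measure \<Rightarrow> (real ^ 'n::finite \<Rightarrow> 't \<Rightarrow> real) \<Rightarrow> bool"
  where "C3_family I \<mu> m \<longleftrightarrow>
    C2_family I \<mu> m \<and>
    (\<forall>t \<in> space \<mu>. cont_partial_diff_on 3 (cube I) (\<lambda>x. m x t)) \<and>
    (\<forall>p \<in> cube I. \<forall>i j l.
      Lq_type_at 3 I \<mu> (fam_partial [i] m) p \<and>
      Lq_type_at (3 / 2) I \<mu> (fam_partial [i, j] m) p \<and>
      Lq_type_at 1 I \<mu> (fam_partial [i, j, l] m) p)"

definition avg :: "'t measure \<Rightarrow> (real ^ 'n \<Rightarrow> 't \<Rightarrow> real) \<Rightarrow> real ^ 'n \<Rightarrow> real"
  where "avg \<mu> \<phi> x = (\<integral>t. \<phi> x t \<partial>\<mu>)"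

definition centered_partial ::
    "'t measure \<Rightarrow> 'n::finite \<Rightarrow> (real ^ 'n \<Rightarrow> 't \<Rightarrow> real) \<Rightarrow> real ^ 'n \<Rightarrow> 't \<Rightarrow> real"
  where "centered_partial \<mu> r m x t = fam_partial [r] m x t - avg \<mu> (fam_partial [r] m) x"

end

theory Submission
  imports Defs
begin

text \<open>
  Write \<open>\<D>\<close> for the determinant \<open>cheb_det f g\<close> and \<open>W\<close> for the Wronskian. The functions \<open>f\<close>, \<open>g\<close> span the
  solutions of \<open>y'' = \<Phi> y' + \<Psi> y\<close>, and the mean at \<open>x\<close> is the zero \<open>y\<close> of the integral of
  \<open>\<D>(m(x, t), y)\<close>; existence and uniqueness of this zero rest on the constant sign of \<open>\<D>\<close> on the
  triangle \<open>u < y\<close>.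

  The substance of the theorem is that the mean determines \<open>\<Phi>\<close> and \<open>\<Psi>\<close>
  (\<open>same_means_imp_same_invariants\<close>). Suppose that two pairs generate the same mean \<open>M\<close>, and let
  \<open>G(u, y)\<close> be the difference of their determinants, each divided by its Wronskian at \<open>y\<close>. Near the
  diagonal
  \<open>G(u, y) = \<Delta>\<Phi>(y) (u - y)\<^sup>2 / 2 + \<dots>\<close>, and the integral of \<open>G(m(x, t), M(x))\<close> vanishes. Let \<open>x\<close> tend to the
  diagonal point \<open>(x\<^sub>0, ..., x\<^sub>0)\<close> along a direction \<open>v\<close>. Then \<open>m - M\<close> is to first order the centered
  directional derivative \<open>\<partial>\<^sub>v\<^sup>*m\<close>, so the second-order terms give \<open>\<Delta>\<Phi>(x\<^sub>0) \<langle>(\<partial>\<^sub>v\<^sup>*m)\<^sup>2\<rangle> = 0\<close>. Once it is known that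
  \<open>\<Delta>\<Phi> = 0\<close> on an interval, then the next coefficient is \<open>\<Delta>\<Psi> / 6\<close>, and the third-order terms give
  \<open>\<Delta>\<Psi>(x\<^sub>0) \<langle>(\<partial>\<^sub>v\<^sup>*m)\<^sup>3\<rangle> = 0\<close>. Polarization turns the given nonzero mixed third moment into a direction with
  \<open>\<langle>(\<partial>\<^sub>v\<^sup>*m)\<^sup>3\<rangle> \<noteq> 0\<close>, and homogeneity of \<open>m\<close> carries it from the one given point to all points of the
  diagonal. The limits under the integral are dominated because the values of a mean lie between the
  coordinates, which bounds its difference quotients at the diagonal.

  The remaining implications are short. Homogeneity of \<open>m\<close> identifies the mean of the rescaled pair
  at \<open>x\<close> with \<open>M(\<lambda>x) / \<lambda>\<close> (\<open>gen_mean_rescale\<close>), which links homogeneity of \<open>M\<close> to equality of means.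
  Pairs with equal \<open>\<Phi>\<close>, \<open>\<Psi>\<close> solve the same linear equation, and quotients of Wronskians of solutions
  are constant, so the pairs are equivalent (\<open>same_invariants_imp_equivalent\<close>); equivalent pairs have
  proportional determinants and hence equal means. Since the invariants of the rescaled pair are
  \<open>\<lambda> \<Phi>(\<lambda>x)\<close> and \<open>\<lambda>\<^sup>2 \<Psi>(\<lambda>x)\<close>, their agreement with those of \<open>(f, g)\<close> says that \<open>x \<Phi>(x)\<close> and \<open>x\<^sup>2 \<Psi>(x)\<close> are
  constant, which is the Euler equation. Its solutions are spanned by the Gini pairs
  (\<open>euler_equation_gini_solutions\<close>), and the determinant of a Gini pair is itself homogeneous
  (\<open>gini_cheb_det_rescale\<close>), so that Gini means are homogeneous.
\<close>

section \<open>Chebyshev systems and the zero of the integrated determinant\<close>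

lemma cheb_det_swap: "cheb_det f g y x = - cheb_det f g x y"
  by (simp add: cheb_det_def)

lemma chebyshev_system_subset:
  "chebyshev_system I f g \<Longrightarrow> J \<subseteq> I \<Longrightarrow> chebyshev_system J f g"
  unfolding chebyshev_system_def by (blast intro: continuous_on_subset)

text \<open>
  The triangle \<open>x < y\<close> in \<open>J \<times> J\<close> is convex, so the determinant, which is continuous and has no
  zero there, keeps its sign. The sign is carried by the factor \<open>\<sigma>\<close> because \<open>(f, g)\<close> and \<open>(g, f)\<close>
  have opposite determinants.
\<close>

lemma chebyshev_system_sign:
  fixes J :: "real set"
  assumes "is_interval J" "chebyshev_system J f g"
  obtains \<sigma> :: real where "\<And>x y. x \<in> J \<Longrightarrow> y \<in> J \<Longrightarrow> x < y \<Longrightarrow> \<sigma> * cheb_det f g x y > 0"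
proof -
  define S where "S = (J \<times> J) \<inter> {p. inner (1, -1) p < 0}"
  define D where "D = (\<lambda>p. cheb_det f g (fst p) (snd p))"
  have S_iff: "p \<in> S \<longleftrightarrow> fst p \<in> J \<and> snd p \<in> J \<and> fst p < snd p" for p
    by (auto simp: S_def inner_prod_def mem_Times_iff)
  have "convex S"
    unfolding S_def using assms(1)
    by (intro convex_Int convex_Times convex_halfspace_lt) (simp_all add: is_interval_convex_1)
  moreover have "continuous_on S D"
  proof -
    have "continuous_on J f" "continuous_on J g"
      using assms(2) by (auto simp: chebyshev_system_def)
    moreover have "fst ` S \<subseteq> J" "snd ` S \<subseteq> J" by (auto simp: S_iff)
    ultimately show ?thesis
      unfolding D_def cheb_det_def
      by (intro continuous_intros continuous_on_compose2[of J f S fst] continuous_on_compose2[of J g S fst]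
          continuous_on_compose2[of J f S snd] continuous_on_compose2[of J g S snd]) 
  qed
  ultimately have conn: "is_interval (D ` S)"
    by (simp add: is_interval_connected_1 connected_continuous_image convex_connected)
  have nz: "0 \<notin> D ` S"
    using assms(2) by (auto simp: chebyshev_system_def S_iff D_def)
  show ?thesis
  proof (cases "\<exists>p\<in>S. D p > 0")
    case True
    then obtain p where p: "p \<in> S" "D p > 0" by blast
    have "D q > 0" if "q \<in> S" for q
    proof (rule ccontr)
      assume "\<not> D q > 0"
      then have "0 \<in> D ` S"
        using conn p that unfolding is_interval_1 by (meson imageI less_imp_le linorder_not_le)
      with nz show False by contradiction
    qed
    then show ?thesis by (intro that[of 1]) (force simp: S_iff D_def)
  next
    case False
    have "D q < 0" if "q \<in> S" for q
    proof -
      have "D q \<noteq> 0" using nz that by force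
      then show ?thesis using False that by force
    qed
    then show ?thesis by (intro that[of "-1"]) (force simp: S_iff D_def)
  qed
qed

lemma (in prob_space) integrable_continuous_comp:
  fixes X :: "'a \<Rightarrow> real" and f :: "real \<Rightarrow> real"
  assumes X: "X \<in> borel_measurable M" "\<And>t. t \<in> space M \<Longrightarrow> X t \<in> {a..b}" and f: "continuous_on {a..b} f"
  shows "integrable M (\<lambda>t. f (X t))"
proof -
  have "X \<in> measurable M (restrict_space borel {a..b})"
    by (rule measurable_restrict_space2) (use X in blast)+
  then have meas: "(\<lambda>t. f (X t)) \<in> borel_measurable M"
    by (rule measurable_compose[OF _ borel_measurable_continuous_on_restrict[OF f]])
  have "bounded (f ` {a..b})"
    by (rule compact_imp_bounded[OF compact_continuous_image[OF f compact_Icc]])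
  then obtain B where B: "\<And>x. x \<in> {a..b} \<Longrightarrow> norm (f x) \<le> B"
    unfolding bounded_iff by blast
  show ?thesis
    by (rule integrable_const_bound[where B = B, OF _ meas]) (intro AE_I2 B X(2))
qed

text \<open>
  As a function of \<open>y\<close> the integral of \<open>\<D>\<^bsub>f,g\<^esub>(X, y)\<close> is the combination \<open>A g(y) - B f(y)\<close> with constant
  \<open>A\<close>, \<open>B\<close>. The sign lemma gives opposite signs at the two ends of the range of \<open>X\<close>, hence a zero. Two
  different zeros would force \<open>A = B = 0\<close>, since the determinant of that linear system is
  \<open>\<D>\<^bsub>f,g\<^esub>(y\<^sub>1, y\<^sub>2)\<close>; but the integral is nonzero at any point of \<open>J\<close> to the left of the range of \<open>X\<close>,
  and such a point exists because \<open>J\<close> is open.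
\<close>

lemma (in prob_space)
  fixes X :: "'a \<Rightarrow> real" and f g :: "real \<Rightarrow> real"
  assumes J: "open J" "is_interval J" and cheb: "chebyshev_system J f g"
    and X: "X \<in> borel_measurable M" "\<And>t. t \<in> space M \<Longrightarrow> X t \<in> {a..b}" and ab: "a \<in> J" "b \<in> J"
  shows integrable_cheb_det: "integrable M (\<lambda>t. cheb_det f g (X t) y)"
    and chebyshev_mean_exists: "\<exists>y\<in>{a..b}. (\<integral>t. cheb_det f g (X t) y \<partial>M) = 0"
    and chebyshev_mean_unique: "y1 \<in> J \<Longrightarrow> y2 \<in> J \<Longrightarrow> (\<integral>t. cheb_det f g (X t) y1 \<partial>M) = 0
      \<Longrightarrow> (\<integral>t. cheb_det f g (X t) y2 \<partial>M) = 0 \<Longrightarrow> y1 = y2"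
proof -
  have sub: "{a..b} \<subseteq> J"
    using mem_is_interval_1_I[OF J(2) ab] by auto
  have cont: "continuous_on {a..b} f" "continuous_on {a..b} g"
    using cheb sub unfolding chebyshev_system_def by (blast intro: continuous_on_subset)+
  have int: "integrable M (\<lambda>t. f (X t))" "integrable M (\<lambda>t. g (X t))"
    using integrable_continuous_comp[OF X cont(1)] integrable_continuous_comp[OF X cont(2)] by auto
  define A B where "A = (\<integral>t. f (X t) \<partial>M)" and "B = (\<integral>t. g (X t) \<partial>M)"
  have int_det: "integrable M (\<lambda>t. cheb_det f g (X t) y)" for y
    unfolding cheb_det_def using int by simp
  then show "integrable M (\<lambda>t. cheb_det f g (X t) y)" .
  have eq: "(\<integral>t. cheb_det f g (X t) y \<partial>M) = A * g y - B * f y" for y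
    unfolding cheb_det_def A_def B_def using int by simp
  obtain \<sigma> where \<sigma>: "\<And>x y. x \<in> J \<Longrightarrow> y \<in> J \<Longrightarrow> x < y \<Longrightarrow> \<sigma> * cheb_det f g x y > 0"
    using chebyshev_system_sign[OF J(2) cheb] by metis
  obtain t0 where "t0 \<in> space M" using not_empty by blast
  then have "a \<le> b" using X(2) by force
  have le: "\<sigma> * cheb_det f g x y \<ge> 0" if "x \<in> J" "y \<in> J" "x \<le> y" for x y
    using \<sigma>[OF that(1,2)] that(3) by (cases "x = y") (auto simp: cheb_det_def less_imp_le)
  have XJ: "X t \<in> J" and aX: "a \<le> X t" and Xb: "X t \<le> b" if "t \<in> space M" for t
    using X(2)[OF that] sub by auto
  have "\<exists>y\<ge>a. y \<le> b \<and> \<sigma> * (A * g y - B * f y) = 0"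
  proof (rule IVT')
    have "0 \<le> (\<integral>t. - (\<sigma> * cheb_det f g (X t) a) \<partial>M)"
      using XJ aX le ab by (intro Bochner_Integration.integral_nonneg) (auto simp: cheb_det_swap[of f g _ a])
    also have "\<dots> = - (\<sigma> * (A * g a - B * f a))" by (simp add: eq)
    finally show "\<sigma> * (A * g a - B * f a) \<le> 0" by simp
    have "0 \<le> (\<integral>t. \<sigma> * cheb_det f g (X t) b \<partial>M)"
      using XJ Xb le ab by (intro Bochner_Integration.integral_nonneg) auto
    also have "\<dots> = \<sigma> * (A * g b - B * f b)" by (simp add: eq)
    finally show "0 \<le> \<sigma> * (A * g b - B * f b)" .
    show "a \<le> b" by fact
    show "continuous_on {a..b} (\<lambda>y. \<sigma> * (A * g y - B * f y))"
      by (intro continuous_intros cont)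
  qed
  moreover obtain z where z: "z \<in> J" "z < a"
  proof -
    obtain e where "e > 0" "cball a e \<subseteq> J"
      using open_contains_cball_eq[OF J(1)] ab(1) by blast
    then have "a - e \<in> J" by (auto simp: dist_real_def subset_iff)
    then show ?thesis using that \<open>e > 0\<close> by force
  qed
  have pos: "(\<integral>t. \<sigma> * cheb_det f g z (X t) \<partial>M) > 0"
  proof -
    have "\<sigma> * cheb_det f g z (X t) > 0" if "t \<in> space M" for t
      using \<sigma>[of z "X t"] X(2)[OF that] sub z by force
    moreover have "integrable M (\<lambda>t. \<sigma> * cheb_det f g z (X t))"
      using int_det[of z] unfolding cheb_det_swap[of f g _ z] by simp
    ultimately show ?thesis
      using integral_less_AE_space[of "\<lambda>_. 0" "\<lambda>t. \<sigma> * cheb_det f g z (X t)"] emeasure_space_1 by auto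
  qed
  then have "\<sigma> \<noteq> 0" by auto
  ultimately show "\<exists>y\<in>{a..b}. (\<integral>t. cheb_det f g (X t) y \<partial>M) = 0"
    by (auto simp: eq)
  show "y1 = y2" if y: "y1 \<in> J" "y2 \<in> J" "(\<integral>t. cheb_det f g (X t) y1 \<partial>M) = 0"
    "(\<integral>t. cheb_det f g (X t) y2 \<partial>M) = 0"
  proof (rule ccontr)
    assume "y1 \<noteq> y2"
    then have nz: "f y1 * g y2 - f y2 * g y1 \<noteq> 0"
      using cheb y unfolding chebyshev_system_def cheb_det_def by blast
    have e: "A * g y1 = B * f y1" "A * g y2 = B * f y2"
      using y eq by auto
    have "A * (f y1 * g y2 - f y2 * g y1) = f y1 * (A * g y2) - f y2 * (A * g y1)"
      by (simp add: algebra_simps)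
    then have "A * (f y1 * g y2 - f y2 * g y1) = 0"
      unfolding e by (simp add: algebra_simps)
    moreover have "B * (f y1 * g y2 - f y2 * g y1) = g y2 * (B * f y1) - g y1 * (B * f y2)"
      by (simp add: algebra_simps)
    then have "B * (f y1 * g y2 - f y2 * g y1) = 0"
      unfolding e[symmetric] by (simp add: algebra_simps)
    ultimately
    have "A = 0" "B = 0" using nz by simp_all
    then have "(\<integral>t. cheb_det f g (X t) z \<partial>M) = 0" by (simp add: eq)
    then have "(\<integral>t. \<sigma> * cheb_det f g z (X t) \<partial>M) = 0"
      unfolding cheb_det_swap[of f g _ z] by simp
    with pos show False by (metis less_irrefl)
  qed
qed

section \<open>The mean generated by a Chebyshev system\<close>

text \<open>
  The interval is a parameter of the locale, so that everything proved here applies to \<open>I\<close> and, through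
  \<open>subinterval_means\<close>, to the intervals \<open>I\<^sub>\<lambda>\<close> as well.
\<close>

locale interval_means = prob_space \<mu> for \<mu> :: "'t measure" +
  fixes I :: "real set" and m :: "real ^ 'n::finite \<Rightarrow> 't \<Rightarrow> real"
  assumes open_I: "open I" and interval_I: "is_interval I"
    and means: "measurable_family_of_means I \<mu> m"
begin

lemma mean_values:
  assumes "x \<in> cube I"
  shows "m x \<in> borel_measurable \<mu>"
    and "t \<in> space \<mu> \<Longrightarrow> m x t \<in> {Min (range (($) x))..Max (range (($) x))}"
    and "Min (range (($) x)) \<in> I" "Max (range (($) x)) \<in> I"
proof -
  show "m x \<in> borel_measurable \<mu>"
    "t \<in> space \<mu> \<Longrightarrow> m x t \<in> {Min (range (($) x))..Max (range (($) x))}"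
    using means assms by (auto simp: measurable_family_of_means_def mean_on_def)
  have "range (($) x) \<subseteq> I" using assms by (auto simp: cube_def)
  then show "Min (range (($) x)) \<in> I" "Max (range (($) x)) \<in> I"
    using Min_in[of "range (($) x)"] Max_in[of "range (($) x)"] by auto
qed

lemma between_coordinates_mem:
  fixes x :: "real ^ 'n"
  assumes "x \<in> cube I" "y \<in> {Min (range (($) x))..Max (range (($) x))}"
  shows "y \<in> I"
  using assms(2) by (auto intro: mem_is_interval_1_I[OF interval_I mean_values(3,4)[OF assms(1)]])

lemma mean_mem: "x \<in> cube I \<Longrightarrow> t \<in> space \<mu> \<Longrightarrow> m x t \<in> I"
  using means by (auto simp: measurable_family_of_means_def mean_on_def)

lemma
  assumes "chebyshev_system I f g" "x \<in> cube I"
  shows integrable_det: "integrable \<mu> (\<lambda>t. cheb_det f g (m x t) y)"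
    and gen_mean_between: "gen_mean I f g m \<mu> x \<in> {Min (range (($) x))..Max (range (($) x))}"
    and gen_mean_mem: "gen_mean I f g m \<mu> x \<in> I"
    and gen_mean_zero: "(\<integral>t. cheb_det f g (m x t) (gen_mean I f g m \<mu> x) \<partial>\<mu>) = 0"
    and gen_mean_eqI: "z \<in> I \<Longrightarrow> (\<integral>t. cheb_det f g (m x t) z \<partial>\<mu>) = 0 \<Longrightarrow> gen_mean I f g m \<mu> x = z"
proof -
  note A = open_I interval_I assms(1) mean_values(1,2)[OF assms(2)] mean_values(3,4)[OF assms(2)]
  show "integrable \<mu> (\<lambda>t. cheb_det f g (m x t) y)"
    by (rule integrable_cheb_det[OF A])
  obtain y where y: "y \<in> {Min (range (($) x))..Max (range (($) x))}"
    "(\<integral>t. cheb_det f g (m x t) y \<partial>\<mu>) = 0"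
    using chebyshev_mean_exists[OF A] by blast
  have yI: "y \<in> I" by (rule between_coordinates_mem[OF assms(2) y(1)])
  have eqI: "gen_mean I f g m \<mu> x = z" if "z \<in> I" "(\<integral>t. cheb_det f g (m x t) z \<partial>\<mu>) = 0" for z
    unfolding gen_mean_def using that chebyshev_mean_unique[OF A] by (intro the_equality) auto
  then show "z \<in> I \<Longrightarrow> (\<integral>t. cheb_det f g (m x t) z \<partial>\<mu>) = 0 \<Longrightarrow> gen_mean I f g m \<mu> x = z" .
  have "gen_mean I f g m \<mu> x = y" by (rule eqI[OF yI y(2)])
  then show "gen_mean I f g m \<mu> x \<in> {Min (range (($) x))..Max (range (($) x))}"
    "gen_mean I f g m \<mu> x \<in> I" "(\<integral>t. cheb_det f g (m x t) (gen_mean I f g m \<mu> x) \<partial>\<mu>) = 0"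
    using y yI by auto
qed

lemma subinterval_means:
  assumes "open J" "is_interval J" "J \<subseteq> I"
  shows "interval_means \<mu> J m"
proof -
  have "m x t \<in> J" if x: "x \<in> cube J" and t: "t \<in> space \<mu>" for x t
  proof -
    have "x \<in> cube I" using x assms(3) by (auto simp: cube_def)
    moreover have "range (($) x) \<subseteq> J" using x by (auto simp: cube_def)
    then have "Min (range (($) x)) \<in> J" "Max (range (($) x)) \<in> J"
      using Min_in[of "range (($) x)"] Max_in[of "range (($) x)"] by auto
    ultimately show ?thesis
      using mean_values(2)[of x t] t by (auto intro: mem_is_interval_1_I[OF assms(2)])
  qed
  moreover have "x \<in> cube I" if "x \<in> cube J" for x :: "real ^ 'n"
    using that assms(3) by (auto simp: cube_def)
  ultimately have "measurable_family_of_means J \<mu> m"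
    using means by (auto simp: measurable_family_of_means_def mean_on_def)
  then show ?thesis
    using assms by unfold_locales
qed

lemma gen_mean_subinterval:
  assumes "open J" "is_interval J" "J \<subseteq> I" "chebyshev_system I f g" "x \<in> cube J"
  shows "gen_mean J f g m \<mu> x = gen_mean I f g m \<mu> x"
proof -
  interpret J: interval_means \<mu> J m by (rule subinterval_means[OF assms(1-3)])
  have cheb: "chebyshev_system J f g" by (rule chebyshev_system_subset[OF assms(4,3)])
  have "x \<in> cube I" using assms(3,5) by (auto simp: cube_def)
  then have "gen_mean I f g m \<mu> x = gen_mean J f g m \<mu> x"
    using J.gen_mean_mem[OF cheb assms(5)] J.gen_mean_zero[OF cheb assms(5)] assms(3)
    by (intro gen_mean_eqI[OF assms(4)]) auto
  then show ?thesis ..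
qed

text \<open>
  Proportionality of the determinants is all that equivalence of two pairs means for the generated
  means. It also relates a Gini pair to its rescaling, whatever the type of the exponents.
\<close>

lemma gen_mean_cong_proportional:
  assumes "K \<noteq> 0" "\<And>u v. u \<in> I \<Longrightarrow> v \<in> I \<Longrightarrow> cheb_det f g u v = K * cheb_det h k u v" "x \<in> cube I"
  shows "gen_mean I f g m \<mu> x = gen_mean I h k m \<mu> x"
proof -
  have "(\<integral>t. cheb_det f g (m x t) y \<partial>\<mu>) = K * (\<integral>t. cheb_det h k (m x t) y \<partial>\<mu>)" if "y \<in> I" for y
  proof -
    have "(\<integral>t. cheb_det f g (m x t) y \<partial>\<mu>) = (\<integral>t. K * cheb_det h k (m x t) y \<partial>\<mu>)"
      using assms(2) mean_mem[OF assms(3)] that by (intro Bochner_Integration.integral_cong) auto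
    then show ?thesis by simp
  qed
  then have "y \<in> I \<and> (\<integral>t. cheb_det f g (m x t) y \<partial>\<mu>) = 0 \<longleftrightarrow>
      y \<in> I \<and> (\<integral>t. cheb_det h k (m x t) y \<partial>\<mu>) = 0" for y
    using assms(1) by auto
  then show ?thesis unfolding gen_mean_def by simp
qed

end

lemma equivalent_pairs_cheb_det:
  assumes "equivalent_pairs J (f, g) (h, k)"
  obtains K where "K \<noteq> 0" "\<And>u v. u \<in> J \<Longrightarrow> v \<in> J \<Longrightarrow> cheb_det f g u v = K * cheb_det h k u v"
proof -
  obtain \<alpha> \<beta> \<gamma> \<delta> where nz: "\<alpha> * \<delta> - \<beta> * \<gamma> \<noteq> 0"
    and *: "\<And>x. x \<in> J \<Longrightarrow> f x = \<alpha> * h x + \<beta> * k x \<and> g x = \<gamma> * h x + \<delta> * k x"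
    using assms by (auto simp: equivalent_pairs_def)
  have "cheb_det f g u v = (\<alpha> * \<delta> - \<beta> * \<gamma>) * cheb_det h k u v" if "u \<in> J" "v \<in> J" for u v
    using *[OF that(1)] *[OF that(2)] by (simp add: cheb_det_def algebra_simps)
  with nz show ?thesis by (rule that)
qed

section \<open>Rescaling and homogeneity\<close>

lemma ratio_set_pos: "I \<subseteq> {0<..} \<Longrightarrow> c \<in> ratio_set I \<Longrightarrow> c > 0"
  by (auto simp: ratio_set_def intro!: divide_pos_pos)

lemma scaled_inter_iff: "c > 0 \<Longrightarrow> x \<in> scaled_inter I c \<longleftrightarrow> x \<in> I \<and> c * x \<in> I"
  by (auto simp: scaled_inter_def image_iff intro: bexI[of _ "c * x"])

lemma scaled_inter_subset: "scaled_inter I c \<subseteq> I"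
  by (auto simp: scaled_inter_def)

lemma
  assumes "c > 0"
  shows open_scaled_inter: "open I \<Longrightarrow> open (scaled_inter I c)"
    and is_interval_scaled_inter: "is_interval I \<Longrightarrow> is_interval (scaled_inter I c)"
proof -
  have eq: "scaled_inter I c = I \<inter> (\<lambda>x. c * x) -` I"
    using scaled_inter_iff[OF assms] by auto
  show "open I \<Longrightarrow> open (scaled_inter I c)"
    unfolding eq by (intro open_Int open_vimage continuous_intros)
  show "is_interval I \<Longrightarrow> is_interval (scaled_inter I c)"
    unfolding eq is_interval_convex_1 
    by (intro convex_Int convex_linear_vimage) (auto simp: linear_iff algebra_simps)
qed

lemma chebyshev_system_rescale:
  assumes "c > 0" "chebyshev_system I f g"
  shows "chebyshev_system (scaled_inter I c) (rescale c f) (rescale c g)"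
proof -
  have sub: "(\<lambda>x. c * x) ` scaled_inter I c \<subseteq> I"
    by (auto simp: scaled_inter_iff[OF assms(1)])
  have "continuous_on (scaled_inter I c) (rescale c f)" "continuous_on (scaled_inter I c) (rescale c g)"
    unfolding rescale_def using assms(2) sub
    by (auto simp: chebyshev_system_def intro: continuous_on_compose2[OF _ continuous_on_mult_const])
  moreover have "cheb_det (rescale c f) (rescale c g) x y \<noteq> 0"
    if "x \<in> scaled_inter I c" "y \<in> scaled_inter I c" "x \<noteq> y" for x y
  proof -
    have "c * x \<in> I" "c * y \<in> I" "c * x \<noteq> c * y"
      using that assms(1) by (auto simp: scaled_inter_iff)
    then show ?thesis
      using assms(2) unfolding chebyshev_system_def cheb_det_def rescale_def by blast
  qed
  ultimately show ?thesis unfolding chebyshev_system_def by blast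
qed

text \<open>
  Because \<open>m\<close> is homogeneous, \<open>\<D>\<^bsub>f,g\<^esub>(m(cx, t), cy)\<close> is the determinant of the rescaled pair at
  \<open>(m(x, t), y)\<close>; so the two defining equations have corresponding solutions.
\<close>

lemma (in interval_means) gen_mean_rescale:
  assumes pos: "I \<subseteq> {0<..}" and hom: "homogeneous_family I \<mu> m" and cheb: "chebyshev_system I f g"
    and c: "c \<in> ratio_set I" and x: "x \<in> cube (scaled_inter I c)"
  shows "gen_mean (scaled_inter I c) (rescale c f) (rescale c g) m \<mu> x
    = gen_mean I f g m \<mu> (c *\<^sub>R x) / c"
proof -
  have c0: "c > 0" by (rule ratio_set_pos[OF pos c])
  interpret J: interval_means \<mu> "scaled_inter I c" m
    by (intro subinterval_means open_scaled_inter is_interval_scaled_inter scaled_inter_subset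
        c0 open_I interval_I)
  let ?y = "gen_mean (scaled_inter I c) (rescale c f) (rescale c g) m \<mu> x"
  have cheb': "chebyshev_system (scaled_inter I c) (rescale c f) (rescale c g)"
    by (rule chebyshev_system_rescale[OF c0 cheb])
  have "gen_mean I f g m \<mu> (c *\<^sub>R x) = c * ?y"
  proof (rule gen_mean_eqI[OF cheb])
    show "c *\<^sub>R x \<in> cube I" using x by (auto simp: cube_def scaled_inter_iff[OF c0])
    show "c * ?y \<in> I" using J.gen_mean_mem[OF cheb' x] by (simp add: scaled_inter_iff[OF c0])
    have "(\<integral>t. cheb_det f g (m (c *\<^sub>R x) t) (c * ?y) \<partial>\<mu>)
        = (\<integral>t. cheb_det (rescale c f) (rescale c g) (m x t) ?y \<partial>\<mu>)"
      using hom c x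
      by (intro Bochner_Integration.integral_cong)
        (auto simp: homogeneous_family_def homogeneous_on_def cheb_det_def rescale_def)
    then show "(\<integral>t. cheb_det f g (m (c *\<^sub>R x) t) (c * ?y) \<partial>\<mu>) = 0"
      using J.gen_mean_zero[OF cheb' x] by simp
  qed
  then show ?thesis using c0 by simp
qed

lemma (in interval_means) homogeneous_iff_rescale:
  assumes "I \<subseteq> {0<..}" "homogeneous_family I \<mu> m" "chebyshev_system I f g"
  shows "homogeneous_on I (gen_mean I f g m \<mu>) \<longleftrightarrow>
      (\<forall>c \<in> ratio_set I. \<forall>x \<in> cube (scaled_inter I c). gen_mean I f g m \<mu> x
          = gen_mean (scaled_inter I c) (rescale c f) (rescale c g) m \<mu> x)"
proof -
  have "gen_mean I f g m \<mu> (c *\<^sub>R x) = c * gen_mean I f g m \<mu> x \<longleftrightarrow> gen_mean I f g m \<mu> x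
          = gen_mean (scaled_inter I c) (rescale c f) (rescale c g) m \<mu> x"
    if "c \<in> ratio_set I" "x \<in> cube (scaled_inter I c)" for c x
    using gen_mean_rescale[OF assms that] ratio_set_pos[OF assms(1) that(1)] by (auto simp: field_simps)
  then show ?thesis unfolding homogeneous_on_def by auto
qed

lemma (in interval_means) proportional_rescaling_imp_homogeneous:
  assumes pos: "I \<subseteq> {0<..}" and hom: "homogeneous_family I \<mu> m" and cheb: "chebyshev_system I f g"
    and proportional: "\<And>c. c \<in> ratio_set I \<Longrightarrow> \<exists>K. K \<noteq> 0 \<and> (\<forall>u\<in>scaled_inter I c. \<forall>v\<in>scaled_inter I c.
      cheb_det f g u v = K * cheb_det (rescale c f) (rescale c g) u v)"
  shows "homogeneous_on I (gen_mean I f g m \<mu>)"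
  unfolding homogeneous_iff_rescale[OF pos hom cheb]
proof (intro ballI)
  fix c and x :: "real ^ 'n" assume c: "c \<in> ratio_set I" and x: "x \<in> cube (scaled_inter I c)"
  have c0: "c > 0" by (rule ratio_set_pos[OF pos c])
  note J = open_scaled_inter[OF c0 open_I] is_interval_scaled_inter[OF c0 interval_I]
    scaled_inter_subset[of I c]
  interpret J: interval_means \<mu> "scaled_inter I c" m by (rule subinterval_means[OF J])
  obtain K where K: "K \<noteq> 0" "\<And>u v. u \<in> scaled_inter I c \<Longrightarrow> v \<in> scaled_inter I c \<Longrightarrow>
      cheb_det f g u v = K * cheb_det (rescale c f) (rescale c g) u v"
    using proportional[OF c] by blast
  show "gen_mean I f g m \<mu> x = gen_mean (scaled_inter I c) (rescale c f) (rescale c g) m \<mu> x"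
    using J.gen_mean_cong_proportional[OF K x] gen_mean_subinterval[OF J cheb x] by simp
qed

section \<open>Scaled moments of an expansion near the diagonal\<close>

text \<open>
  Lagrange's form of the remainder in the variable \<open>u\<close> with centre \<open>w\<close>: all lower terms vanish on the
  diagonal, and joint continuity of the last derivative makes the error uniform in both variables.
\<close>

lemma uniform_taylor:
  fixes G :: "nat \<Rightarrow> real \<Rightarrow> real \<Rightarrow> real"
  assumes J: "is_interval J" and x0: "x0 \<in> J" and k: "k > 0"
    and der: "\<And>j u y. j < k \<Longrightarrow> u \<in> J \<Longrightarrow> y \<in> J \<Longrightarrow>
      ((\<lambda>u. G j u y) has_real_derivative G (Suc j) u y) (at u)"
    and zero: "\<And>j y. j < k \<Longrightarrow> y \<in> J \<Longrightarrow> G j y y = 0"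
    and cont: "continuous_on (J \<times> J) (\<lambda>p. G k (fst p) (snd p))"
    and e: "e > 0"
  shows "\<exists>d>0. \<forall>u\<in>J. \<forall>w\<in>J. \<bar>u - x0\<bar> < d \<longrightarrow> \<bar>w - x0\<bar> < d \<longrightarrow>
    \<bar>G 0 u w - G k x0 x0 / fact k * (u - w) ^ k\<bar> \<le> e * \<bar>u - w\<bar> ^ k"
proof -
  have "\<exists>d>0. \<forall>p\<in>J \<times> J. dist p (x0, x0) < d \<longrightarrow> dist (G k (fst p) (snd p)) (G k x0 x0) < e"
    using cont x0 e unfolding continuous_on_iff by fastforce
  then obtain d where d: "d > 0"
    and near: "\<And>p. p \<in> J \<times> J \<Longrightarrow> dist p (x0, x0) < d \<Longrightarrow> dist (G k (fst p) (snd p)) (G k x0 x0) < e"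
    by blast
  have near': "\<bar>G k u w - G k x0 x0\<bar> < e" if "u \<in> J" "w \<in> J" "\<bar>u - x0\<bar> < d / 2" "\<bar>w - x0\<bar> < d / 2" for u w
  proof -
    have "dist (u, w) (x0, x0) \<le> \<bar>u - x0\<bar> + \<bar>w - x0\<bar>"
      unfolding dist_Pair_Pair dist_real_def using sqrt_sum_squares_le_sum_abs by force
    also have "\<dots> < d" using that(3,4) by simp
    finally show ?thesis using near[of "(u, w)"] that by (simp add: dist_real_def)
  qed
  have "\<bar>G 0 u w - G k x0 x0 / fact k * (u - w) ^ k\<bar> \<le> e * \<bar>u - w\<bar> ^ k"
    if u: "u \<in> J" "\<bar>u - x0\<bar> < d / 2" and w: "w \<in> J" "\<bar>w - x0\<bar> < d / 2" for u w
  proof (cases "u = w")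
    case True
    then show ?thesis using zero[OF k w(1)] k by (simp add: power_0_left)
  next
    case False
    have seg: "t \<in> J" if "min u w \<le> t" "t \<le> max u w" for t
      by (rule mem_is_interval_1_I[OF J _ _ that]) (use u w in \<open>auto simp: min_def max_def\<close>)
    have "\<exists>t. (if u < w then u < t \<and> t < w else w < t \<and> t < u) \<and>
        G 0 u w = (\<Sum>j<k. G j w w / fact j * (u - w) ^ j) + G k t w / fact k * (u - w) ^ k"
      by (rule Taylor[where a = "min u w" and b = "max u w" and diff = "\<lambda>j u. G j u w"])
        (use k False seg w(1) der in auto)
    then obtain t where t: "if u < w then u < t \<and> t < w else w < t \<and> t < u"
      and eq: "G 0 u w = (\<Sum>j<k. G j w w / fact j * (u - w) ^ j) + G k t w / fact k * (u - w) ^ k"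
      by blast
    have tJ: "t \<in> J" using t by (intro seg) (auto split: if_splits)
    have td: "\<bar>t - x0\<bar> < d / 2" using t u(2) w(2) unfolding abs_less_iff by (cases "u < w") auto
    have "(\<Sum>j<k. G j w w / fact j * (u - w) ^ j) = 0"
      using zero w(1) by (intro sum.neutral) auto
    then have "G 0 u w - G k x0 x0 / fact k * (u - w) ^ k = (G k t w - G k x0 x0) / fact k * (u - w) ^ k"
      using eq by (simp add: diff_divide_distrib algebra_simps)
    also have "\<bar>\<dots>\<bar> = \<bar>G k t w - G k x0 x0\<bar> / fact k * \<bar>u - w\<bar> ^ k"
      by (simp add: abs_mult power_abs)
    also have "\<dots> \<le> e * \<bar>u - w\<bar> ^ k"
    proof (rule mult_right_mono)
      have "\<bar>G k t w - G k x0 x0\<bar> / fact k \<le> \<bar>G k t w - G k x0 x0\<bar> / 1"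
        by (intro divide_left_mono) (auto simp: fact_ge_1)
      then show "\<bar>G k t w - G k x0 x0\<bar> / fact k \<le> e"
        using near'[OF tJ w(1) td w(2)] by simp
    qed simp
    finally show ?thesis .
  qed
  then show ?thesis using d by (intro exI[of _ "d / 2"]) auto
qed

text \<open>
  After division by \<open>s\<^sub>n\<^sup>k\<close> the variables \<open>(X\<^sub>n - y\<^sub>n) / s\<^sub>n\<close> are bounded by \<open>2K\<close>, so the uniform expansion
  of \<open>\<delta>\<close> turns the vanishing of its integral into the vanishing, in the limit, of its leading term.
\<close>

lemma (in prob_space) scaled_moment_tendsto_0:
  fixes X :: "nat \<Rightarrow> 'a \<Rightarrow> real" and y s :: "nat \<Rightarrow> real" and \<delta> :: "real \<Rightarrow> real \<Rightarrow> real"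
  assumes \<delta>: "\<And>e. e > 0 \<Longrightarrow> \<exists>d>0. \<forall>u\<in>J. \<forall>w\<in>J. \<bar>u - x0\<bar> < d \<longrightarrow> \<bar>w - x0\<bar> < d \<longrightarrow>
      \<bar>\<delta> u w - R * (u - w) ^ k\<bar> \<le> e * \<bar>u - w\<bar> ^ k"
    and s: "\<And>n. s n > 0" "s \<longlonglongrightarrow> 0"
    and X: "\<And>n. X n \<in> borel_measurable M" "\<And>n t. t \<in> space M \<Longrightarrow> X n t \<in> J"
      "\<And>n t. t \<in> space M \<Longrightarrow> \<bar>X n t - x0\<bar> \<le> K * s n"
    and y: "\<And>n. y n \<in> J" "\<And>n. \<bar>y n - x0\<bar> \<le> K * s n"
    and int: "\<And>n. integrable M (\<lambda>t. \<delta> (X n t) (y n))" "\<And>n. (\<integral>t. \<delta> (X n t) (y n) \<partial>M) = 0"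
  shows "(\<lambda>n. R * (\<integral>t. ((X n t - y n) / s n) ^ k \<partial>M)) \<longlonglongrightarrow> 0"
proof (rule LIMSEQ_I)
  fix r :: real assume "r > 0"
  have K: "K \<ge> 0"
  proof -
    have "0 \<le> K * s 0" using y(2)[of 0] by linarith
    then show ?thesis using s(1)[of 0] by (simp add: zero_le_mult_iff)
  qed
  \<comment> \<open>The summand \<open>1\<close> keeps the denominator positive when \<open>K = 0\<close>.\<close>
  define e where "e = r / ((2 * K) ^ k + 1)"
  have pos: "(2 * K) ^ k + 1 > 0" using K by (simp add: add_nonneg_pos)
  then have e: "e > 0" using \<open>r > 0\<close> by (simp add: e_def)
  have er: "e * (2 * K) ^ k < r" using pos \<open>r > 0\<close> by (simp add: e_def field_simps)
  obtain d where d: "d > 0" and exp: "\<And>u w. u \<in> J \<Longrightarrow> w \<in> J \<Longrightarrow> \<bar>u - x0\<bar> < d \<Longrightarrow> \<bar>w - x0\<bar> < d \<Longrightarrow>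
      \<bar>\<delta> u w - R * (u - w) ^ k\<bar> \<le> e * \<bar>u - w\<bar> ^ k"
    using \<delta>[OF e] by blast
  have "(\<lambda>n. K * s n) \<longlonglongrightarrow> 0" using tendsto_mult_right_zero[OF s(2)] .
  then have "\<forall>\<^sub>F n in sequentially. K * s n < d" using d by (rule order_tendstoD(2))
  then obtain N where N: "\<And>n. n \<ge> N \<Longrightarrow> K * s n < d"
    unfolding eventually_sequentially by blast
  have "norm (R * (\<integral>t. ((X n t - y n) / s n) ^ k \<partial>M) - 0) < r" if n: "n \<ge> N" for n
  proof -
    let ?Z = "\<lambda>t. (X n t - y n) / s n"
    let ?h = "\<lambda>t. R * ?Z t ^ k - \<delta> (X n t) (y n) / s n ^ k"
    have Z: "\<bar>?Z t\<bar> \<le> 2 * K" if "t \<in> space M" for t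
    proof -
      have "\<bar>X n t - y n\<bar> \<le> 2 * K * s n" using X(3)[OF that, of n] y(2)[of n] by linarith
      then show ?thesis using s(1)[of n] by (simp add: field_simps)
    qed
    have intZ: "integrable M (\<lambda>t. ?Z t ^ k)"
    proof (rule integrable_const_bound[where B = "(2 * K) ^ k"])
      show "AE t in M. norm (?Z t ^ k) \<le> (2 * K) ^ k"
        by (rule AE_I2) (unfold real_norm_def power_abs, intro power_mono Z, auto)
      show "(\<lambda>t. ?Z t ^ k) \<in> borel_measurable M"
        using X(1)[of n] by measurable
    qed
    have "\<bar>?h t\<bar> \<le> e * (2 * K) ^ k" if t: "t \<in> space M" for t
    proof -
      have "?h t = - (\<delta> (X n t) (y n) - R * (X n t - y n) ^ k) / s n ^ k"
        unfolding power_divide by (simp add: diff_divide_distrib)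
      then have "\<bar>?h t\<bar> = \<bar>\<delta> (X n t) (y n) - R * (X n t - y n) ^ k\<bar> / s n ^ k"
        using s(1)[of n] by (simp add: abs_minus_commute)
      also have "\<dots> \<le> e * \<bar>X n t - y n\<bar> ^ k / s n ^ k"
        using s(1)[of n] N[OF n] X(3)[OF t, of n] y(2)[of n]
        by (intro divide_right_mono exp X(2)[OF t] y(1)) auto
      also have "\<dots> = e * \<bar>?Z t\<bar> ^ k"
        using s(1)[of n] by (simp add: power_divide)
      also have "\<dots> \<le> e * (2 * K) ^ k"
        using Z[OF t] e by (intro mult_left_mono power_mono) auto
      finally show ?thesis .
    qed
    moreover have "integrable M ?h" using intZ int(1)[of n] by simp
    ultimately have "\<bar>\<integral>t. ?h t \<partial>M\<bar> \<le> e * (2 * K) ^ k"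
      using integral_le_const[of ?h "e * (2 * K) ^ k"] integral_ge_const[of ?h "- (e * (2 * K) ^ k)"]
      by (force simp: abs_le_iff)
    moreover have "(\<integral>t. ?h t \<partial>M) = R * (\<integral>t. ?Z t ^ k \<partial>M)"
      using intZ int[of n] by simp
    ultimately show ?thesis using er by simp
  qed
  then show "\<exists>N. \<forall>n\<ge>N. norm (R * (\<integral>t. ((X n t - y n) / s n) ^ k \<partial>M) - 0) < r" by blast
qed

text \<open>
  The function \<open>\<epsilon>\<close> has leading term \<open>u - w\<close>. The vanishing of its integral determines \<open>y\<^sub>n\<close> to first order:
  \<open>(y\<^sub>n - x\<^sub>0) / s\<^sub>n\<close> tends to the expectation of \<open>D\<close>. With this, the \<open>k\<close>-th scaled moments tend to the
  \<open>k\<close>-th central moment of \<open>D\<close> by dominated convergence, and the previous lemma, applied to \<open>\<delta>\<close>, says that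
  \<open>R\<close> times this moment is \<open>0\<close>.
\<close>

lemma (in prob_space) scaled_moment_coefficient_eq_0:
  fixes X :: "nat \<Rightarrow> 'a \<Rightarrow> real" and y s :: "nat \<Rightarrow> real" and \<epsilon> \<delta> :: "real \<Rightarrow> real \<Rightarrow> real"
  assumes \<epsilon>: "\<And>e. e > 0 \<Longrightarrow> \<exists>d>0. \<forall>u\<in>J. \<forall>w\<in>J. \<bar>u - x0\<bar> < d \<longrightarrow> \<bar>w - x0\<bar> < d \<longrightarrow>
      \<bar>\<epsilon> u w - 1 * (u - w) ^ 1\<bar> \<le> e * \<bar>u - w\<bar> ^ 1"
    and \<delta>: "\<And>e. e > 0 \<Longrightarrow> \<exists>d>0. \<forall>u\<in>J. \<forall>w\<in>J. \<bar>u - x0\<bar> < d \<longrightarrow> \<bar>w - x0\<bar> < d \<longrightarrow>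
      \<bar>\<delta> u w - R * (u - w) ^ k\<bar> \<le> e * \<bar>u - w\<bar> ^ k"
    and s: "\<And>n. s n > 0" "s \<longlonglongrightarrow> 0"
    and X: "\<And>n. X n \<in> borel_measurable M" "\<And>n t. t \<in> space M \<Longrightarrow> X n t \<in> J"
      "\<And>n t. t \<in> space M \<Longrightarrow> \<bar>X n t - x0\<bar> \<le> K * s n"
    and y: "\<And>n. y n \<in> J" "\<And>n. \<bar>y n - x0\<bar> \<le> K * s n"
    and int_\<epsilon>: "\<And>n. integrable M (\<lambda>t. \<epsilon> (X n t) (y n))" "\<And>n. (\<integral>t. \<epsilon> (X n t) (y n) \<partial>M) = 0"
    and int_\<delta>: "\<And>n. integrable M (\<lambda>t. \<delta> (X n t) (y n))" "\<And>n. (\<integral>t. \<delta> (X n t) (y n) \<partial>M) = 0"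
    and D: "\<And>t. t \<in> space M \<Longrightarrow> (\<lambda>n. (X n t - x0) / s n) \<longlonglongrightarrow> D t"
    and nz: "(\<integral>t. (D t - (\<integral>t. D t \<partial>M)) ^ k \<partial>M) \<noteq> 0"
  shows "R = 0"
proof -
  have K: "\<bar>(X n t - x0) / s n\<bar> \<le> K" if "t \<in> space M" for n t
    using X(3)[OF that, of n] s(1)[of n] by (simp add: field_simps)
  have Ky: "\<bar>(y n - x0) / s n\<bar> \<le> K" for n
    using y(2)[of n] s(1)[of n] by (simp add: field_simps)
  have D_meas: "D \<in> borel_measurable M"
    using X(1) by (intro borel_measurable_LIMSEQ_real[OF D]) auto
  have A: "(\<lambda>n. \<integral>t. (X n t - x0) / s n \<partial>M) \<longlonglongrightarrow> (\<integral>t. D t \<partial>M)"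
    using X(1) D D_meas K by (intro integral_dominated_convergence[where w = "\<lambda>_. K"]) auto
  have "(\<lambda>n. 1 * (\<integral>t. ((X n t - y n) / s n) ^ 1 \<partial>M)) \<longlonglongrightarrow> 0"
    by (rule scaled_moment_tendsto_0[OF \<epsilon> s X y int_\<epsilon>])
  moreover have "1 * (\<integral>t. ((X n t - y n) / s n) ^ 1 \<partial>M) = (\<integral>t. (X n t - x0) / s n \<partial>M) - (y n - x0) / s n" for n
  proof -
    have "integrable M (\<lambda>t. (X n t - x0) / s n)"
      using K X(1) by (intro integrable_const_bound[where B = K]) auto
    then have "(\<integral>t. (X n t - x0) / s n - (y n - x0) / s n \<partial>M) = (\<integral>t. (X n t - x0) / s n \<partial>M) - (y n - x0) / s n"
      by (simp add: prob_space)
    then show ?thesis by (simp add: diff_divide_distrib)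
  qed
  ultimately have "(\<lambda>n. (\<integral>t. (X n t - x0) / s n \<partial>M) - (y n - x0) / s n) \<longlonglongrightarrow> 0" by simp
  from tendsto_diff[OF A this] have Y: "(\<lambda>n. (y n - x0) / s n) \<longlonglongrightarrow> (\<integral>t. D t \<partial>M)" by simp
  have "(\<lambda>n. \<integral>t. ((X n t - y n) / s n) ^ k \<partial>M) \<longlonglongrightarrow> (\<integral>t. (D t - (\<integral>t. D t \<partial>M)) ^ k \<partial>M)"
  proof (rule integral_dominated_convergence[where w = "\<lambda>_. (2 * K) ^ k"])
    show "AE t in M. (\<lambda>n. ((X n t - y n) / s n) ^ k) \<longlonglongrightarrow> (D t - (\<integral>t. D t \<partial>M)) ^ k"
    proof (rule AE_I2)
      fix t assume "t \<in> space M"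
      from tendsto_power[OF tendsto_diff[OF D[OF this] Y], of k]
      show "(\<lambda>n. ((X n t - y n) / s n) ^ k) \<longlonglongrightarrow> (D t - (\<integral>t. D t \<partial>M)) ^ k"
        by (simp add: diff_divide_distrib)
    qed
    show "AE t in M. norm (((X n t - y n) / s n) ^ k) \<le> (2 * K) ^ k" for n
    proof (rule AE_I2)
      fix t assume t: "t \<in> space M"
      have "\<bar>(X n t - y n) / s n\<bar> \<le> 2 * K"
        using K[OF t, of n] Ky[of n] by (simp add: diff_divide_distrib)
      then show "norm (((X n t - y n) / s n) ^ k) \<le> (2 * K) ^ k"
        unfolding real_norm_def power_abs by (intro power_mono) auto
    qed
  qed (use X(1) D_meas in auto)
  then have "(\<lambda>n. R * (\<integral>t. ((X n t - y n) / s n) ^ k \<partial>M)) \<longlonglongrightarrow> R * (\<integral>t. (D t - (\<integral>t. D t \<partial>M)) ^ k \<partial>M)"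
    by (rule tendsto_mult_left)
  from LIMSEQ_unique[OF this scaled_moment_tendsto_0[OF \<delta> s X y int_\<delta>]]
  show "R = 0" using nz by simp
qed

section \<open>The differential equation of a smooth Chebyshev pair\<close>

lemma cont_diff_on_DERIV:
  assumes "cont_diff_on n I f" "k < n" "x \<in> I"
  shows "((deriv ^^ k) f has_real_derivative (deriv ^^ Suc k) f x) (at x)"
proof -
  have "(deriv ^^ k) f differentiable (at x)" using assms by (auto simp: cont_diff_on_def)
  then show ?thesis by (simp add: DERIV_deriv_iff_real_differentiable)
qed

lemma cont_diff_on_continuous:
  assumes "cont_diff_on n I f" "k \<le> n"
  shows "continuous_on I ((deriv ^^ k) f)"
proof (cases "k = n")
  case True
  then show ?thesis using assms(1) by (simp add: cont_diff_on_def)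
next
  case False
  then have "k < n" using assms(2) by simp
  then show ?thesis
    using DERIV_isCont[OF cont_diff_on_DERIV[OF assms(1)]]
    by (intro continuous_at_imp_continuous_on) blast
qed

lemma smooth_chebyshev_DERIV:
  assumes "smooth_chebyshev n I f g" "k < n" "x \<in> I"
  shows "((deriv ^^ k) f has_real_derivative (deriv ^^ Suc k) f x) (at x)"
    and "((deriv ^^ k) g has_real_derivative (deriv ^^ Suc k) g x) (at x)"
  using assms by (auto simp: smooth_chebyshev_def intro!: cont_diff_on_DERIV simp del: funpow.simps)

lemma smooth_chebyshev_imp_chebyshev: "smooth_chebyshev n I f g \<Longrightarrow> chebyshev_system I f g"
  by (simp add: smooth_chebyshev_def)

lemma smooth_chebyshev_wronskian: "smooth_chebyshev n I f g \<Longrightarrow> x \<in> I \<Longrightarrow> wronskian f g x \<noteq> 0"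
  by (simp add: smooth_chebyshev_def)

lemma smooth_chebyshev_subset:
  "smooth_chebyshev n I f g \<Longrightarrow> J \<subseteq> I \<Longrightarrow> smooth_chebyshev n J f g"
  unfolding smooth_chebyshev_def cont_diff_on_def
  by (meson chebyshev_system_subset continuous_on_subset subsetD)

text \<open>
  \<open>\<Phi>\<close> and \<open>\<Psi>\<close> are the coefficients, found by Cramer's rule, of the one equation \<open>y'' = \<Phi> y' + \<Psi> y\<close> that
  both functions of the pair solve.
\<close>

lemma solves_own_ode:
  assumes "wronskian f g x \<noteq> 0"
  shows "deriv (deriv f) x = Phi f g x * deriv f x + Psi f g x * f x"
    and "deriv (deriv g) x = Phi f g x * deriv g x + Psi f g x * g x"
proof -
  have "Phi f g x * deriv f x + Psi f g x * f x = deriv (deriv f) x * wronskian f g x / wronskian f g x"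
    unfolding Phi_def Psi_def using assms
    by (simp add: field_simps) (simp add: wronskian_def algebra_simps)
  then show "deriv (deriv f) x = Phi f g x * deriv f x + Psi f g x * f x"
    using assms by simp
  have "Phi f g x * deriv g x + Psi f g x * g x = deriv (deriv g) x * wronskian f g x / wronskian f g x"
    unfolding Phi_def Psi_def using assms
    by (simp add: field_simps) (simp add: wronskian_def algebra_simps)
  then show "deriv (deriv g) x = Phi f g x * deriv g x + Psi f g x * g x"
    using assms by simp
qed

lemma ode_determines_invariants:
  assumes "wronskian f g x \<noteq> 0"
    and "deriv (deriv f) x = P * deriv f x + Q * f x" "deriv (deriv g) x = P * deriv g x + Q * g x"
  shows "Phi f g x = P" and "Psi f g x = Q"
proof -
  show "Phi f g x = P"
    unfolding Phi_def using assms(1)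
    by (simp add: assms(2,3) divide_eq_eq) (simp add: wronskian_def algebra_simps)
  show "Psi f g x = Q"
    unfolding Psi_def using assms(1)
    by (simp add: assms(2,3) minus_divide_left divide_eq_eq) (simp add: wronskian_def algebra_simps)
qed

lemma
  assumes c: "c > 0" and I: "open I" and f: "cont_diff_on n I f"
  shows higher_deriv_rescale: "k \<le> n \<Longrightarrow> x \<in> scaled_inter I c \<Longrightarrow>
      (deriv ^^ k) (rescale c f) x = c ^ k * (deriv ^^ k) f (c * x)"
    and cont_diff_on_rescale: "cont_diff_on n (scaled_inter I c) (rescale c f)"
proof -
  have J: "open (scaled_inter I c)" by (rule open_scaled_inter[OF c I])
  have step: "((deriv ^^ k) (rescale c f) has_real_derivative c ^ Suc k * (deriv ^^ Suc k) f (c * x)) (at x)"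
    if IH: "\<And>x. x \<in> scaled_inter I c \<Longrightarrow> (deriv ^^ k) (rescale c f) x = c ^ k * (deriv ^^ k) f (c * x)"
      and k: "k < n" and x: "x \<in> scaled_inter I c" for k x
  proof (rule has_field_derivative_transform_within_open[OF _ J x])
    have cx: "c * x \<in> I" using x by (simp add: scaled_inter_iff[OF c])
    have "((\<lambda>x. (deriv ^^ k) f (c * x)) has_real_derivative (deriv ^^ Suc k) f (c * x) * c) (at x)"
      by (rule DERIV_chain2[where f = "(deriv ^^ k) f" and g = "\<lambda>x. c * x", OF cont_diff_on_DERIV[OF f k cx]]) (auto intro!: derivative_eq_intros)
    from DERIV_cmult[OF this, of "c ^ k"]
    show "((\<lambda>x. c ^ k * (deriv ^^ k) f (c * x)) has_real_derivative c ^ Suc k * (deriv ^^ Suc k) f (c * x)) (at x)"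
      by (simp add: algebra_simps)
  qed (use IH in simp)
  have main: "(deriv ^^ k) (rescale c f) x = c ^ k * (deriv ^^ k) f (c * x)"
    if "k \<le> n" "x \<in> scaled_inter I c" for k x
    using that
  proof (induction k arbitrary: x)
    case 0
    then show ?case by (simp add: rescale_def)
  next
    case (Suc k)
    then have "((deriv ^^ k) (rescale c f) has_real_derivative c ^ Suc k * (deriv ^^ Suc k) f (c * x)) (at x)"
      by (intro step) auto
    from DERIV_imp_deriv[OF this] show ?case by simp
  qed
  then show "k \<le> n \<Longrightarrow> x \<in> scaled_inter I c \<Longrightarrow>
      (deriv ^^ k) (rescale c f) x = c ^ k * (deriv ^^ k) f (c * x)" .
  have "(deriv ^^ k) (rescale c f) differentiable (at x)" if "k < n" "x \<in> scaled_inter I c" for k x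
    unfolding real_differentiable_def using step[OF main that] that(1) by auto
  moreover have "continuous_on (scaled_inter I c) (\<lambda>x. c ^ n * (deriv ^^ n) f (c * x))"
    by (intro continuous_intros continuous_on_compose2[OF cont_diff_on_continuous[OF f order_refl]])
      (auto simp: scaled_inter_iff[OF c])
  then have "continuous_on (scaled_inter I c) ((deriv ^^ n) (rescale c f))"
    by (rule continuous_on_eq) (simp add: main)
  ultimately show "cont_diff_on n (scaled_inter I c) (rescale c f)"
    by (simp add: cont_diff_on_def)
qed

lemma
  assumes c: "c > 0" and I: "open I" and fg: "smooth_chebyshev n I f g"
  shows wronskian_rescale: "1 \<le> n \<Longrightarrow> x \<in> scaled_inter I c \<Longrightarrow>
      wronskian (rescale c f) (rescale c g) x = c * wronskian f g (c * x)"
    and Phi_rescale: "2 \<le> n \<Longrightarrow> x \<in> scaled_inter I c \<Longrightarrow>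
      Phi (rescale c f) (rescale c g) x = c * Phi f g (c * x)"
    and Psi_rescale: "2 \<le> n \<Longrightarrow> x \<in> scaled_inter I c \<Longrightarrow>
      Psi (rescale c f) (rescale c g) x = c\<^sup>2 * Psi f g (c * x)"
    and smooth_chebyshev_rescale: "1 \<le> n \<Longrightarrow>
      smooth_chebyshev n (scaled_inter I c) (rescale c f) (rescale c g)"
proof -
  have f: "cont_diff_on n I f" and g: "cont_diff_on n I g"
    using fg by (simp_all add: smooth_chebyshev_def)
  note d1 = higher_deriv_rescale[OF c I f, of 1] higher_deriv_rescale[OF c I g, of 1]
  note d2 = higher_deriv_rescale[OF c I f, of 2] higher_deriv_rescale[OF c I g, of 2]
  show W: "wronskian (rescale c f) (rescale c g) x = c * wronskian f g (c * x)"
    if "1 \<le> n" "x \<in> scaled_inter I c" for x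
    using d1[of x] that by (simp add: wronskian_def algebra_simps) (simp add: rescale_def)
  show "Phi (rescale c f) (rescale c g) x = c * Phi f g (c * x)"
    if "2 \<le> n" "x \<in> scaled_inter I c" for x
  proof -
    have "Phi (rescale c f) (rescale c g) x
        = c * (c * (deriv (deriv f) (c * x) * g (c * x) - f (c * x) * deriv (deriv g) (c * x)))
          / (c * wronskian f g (c * x))"
      using d2[of x] W[of x] that by (simp add: Phi_def numeral_2_eq_2 algebra_simps) (simp add: rescale_def)
    then show ?thesis using c by (simp add: Phi_def)
  qed
  show "Psi (rescale c f) (rescale c g) x = c\<^sup>2 * Psi f g (c * x)"
    if "2 \<le> n" "x \<in> scaled_inter I c" for x
  proof -
    have "Psi (rescale c f) (rescale c g) x = - (c * (c\<^sup>2 *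
          (deriv (deriv f) (c * x) * deriv g (c * x) - deriv f (c * x) * deriv (deriv g) (c * x)))
          / (c * wronskian f g (c * x)))"
      using d1[of x] d2[of x] W[of x] that by (simp add: Psi_def numeral_2_eq_2 algebra_simps)
    then show ?thesis using c by (simp add: Psi_def)
  qed
  show "smooth_chebyshev n (scaled_inter I c) (rescale c f) (rescale c g)" if "1 \<le> n"
    using fg f g that c W chebyshev_system_rescale[OF c, of I f g]
    by (simp add: smooth_chebyshev_def cont_diff_on_rescale[OF c I] scaled_inter_iff[OF c])
qed

text \<open>
  The \<open>j\<close>-th derivative in \<open>u\<close> of \<open>\<D>\<^bsub>f,g\<^esub>(u, y) / W(y)\<close>, where \<open>W\<close> is the Wronskian. Dividing by \<open>W(y)\<close> does
  not change the zeros of the integral and makes the first derivative on the diagonal equal to \<open>1\<close>;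
  two pairs then differ only from the second order on.
\<close>

definition normalized_det :: "(real \<Rightarrow> real) \<Rightarrow> (real \<Rightarrow> real) \<Rightarrow> nat \<Rightarrow> real \<Rightarrow> real \<Rightarrow> real"
  where "normalized_det f g j u y =
    ((deriv ^^ j) f u * g y - f y * (deriv ^^ j) g u) / wronskian f g y"

lemma normalized_det_0: "normalized_det f g 0 u y = cheb_det f g u y / wronskian f g y"
  by (simp add: normalized_det_def cheb_det_def)

lemma normalized_det_diagonal:
  shows "normalized_det f g 0 y y = 0"
    and "wronskian f g y \<noteq> 0 \<Longrightarrow> normalized_det f g 1 y y = 1"
    and "normalized_det f g 2 y y = Phi f g y"
  by (simp_all add: normalized_det_def wronskian_def Phi_def numeral_2_eq_2)

lemma DERIV_normalized_det:
  assumes "smooth_chebyshev n I f g" "j < n" "u \<in> I" 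
  shows "((\<lambda>u. normalized_det f g j u y) has_real_derivative normalized_det f g (Suc j) u y) (at u)"
  unfolding normalized_det_def
  by (intro DERIV_cdivide DERIV_diff DERIV_cmult DERIV_cmult_right smooth_chebyshev_DERIV[OF assms])

lemma continuous_on_normalized_det:
  assumes fg: "smooth_chebyshev n I f g" and "k \<le> n" "1 \<le> n"
  shows "continuous_on (I \<times> I) (\<lambda>p. normalized_det f g k (fst p) (snd p))"
proof -
  have f: "cont_diff_on n I f" and g: "cont_diff_on n I g"
    using fg by (simp_all add: smooth_chebyshev_def)
  have cont_fst: "continuous_on (I \<times> I) (\<lambda>p. (deriv ^^ j) h (fst p))"
    and cont_snd: "continuous_on (I \<times> I) (\<lambda>p. (deriv ^^ j) h (snd p))"
    if "cont_diff_on n I h" "j \<le> n" for h j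
    by (rule continuous_on_compose2[OF cont_diff_on_continuous[OF that]];
        auto intro!: continuous_intros)+
  have "continuous_on (I \<times> I) (\<lambda>p. f (snd p))" "continuous_on (I \<times> I) (\<lambda>p. g (snd p))"
    "continuous_on (I \<times> I) (\<lambda>p. deriv f (snd p))" "continuous_on (I \<times> I) (\<lambda>p. deriv g (snd p))"
    using cont_snd[OF f, of 0] cont_snd[OF g, of 0] cont_snd[OF f, of 1] cont_snd[OF g, of 1] assms(3)
    by simp_all
  then show ?thesis
    unfolding normalized_det_def wronskian_def
    using smooth_chebyshev_wronskian[OF fg]
    by (intro continuous_intros cont_fst f g assms(2)) (auto simp: wronskian_def)
qed

text \<open>
  The derivative of the Wronskian is the numerator of \<open>\<Phi>\<close>, so the quotient rule expresses the third
  normalized derivative on the diagonal as \<open>\<Phi>' + \<Phi>\<^sup>2 + \<Psi>\<close>. Once \<open>\<Phi>\<close> is known, on an open set, this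
  derivative therefore determines \<open>\<Psi>\<close>.
\<close>

lemma DERIV_Phi:
  assumes "smooth_chebyshev 3 I f g" "x \<in> I"
  shows "(Phi f g has_real_derivative normalized_det f g 3 x x - (Phi f g x)\<^sup>2 - Psi f g x) (at x)"
proof -
  note d = smooth_chebyshev_DERIV[OF assms(1) _ assms(2)]
  have d0: "(f has_real_derivative deriv f x) (at x)" "(g has_real_derivative deriv g x) (at x)"
    using d[of 0] by simp_all
  have d1: "(deriv f has_real_derivative deriv (deriv f) x) (at x)"
    "(deriv g has_real_derivative deriv (deriv g) x) (at x)"
    using d[of 1] by simp_all
  have d2: "(deriv (deriv f) has_real_derivative (deriv ^^ 3) f x) (at x)"
    "(deriv (deriv g) has_real_derivative (deriv ^^ 3) g x) (at x)"
    using d[of 2] by (simp_all add: numeral_2_eq_2 numeral_3_eq_3)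
  have W: "wronskian f g x \<noteq> 0" by (rule smooth_chebyshev_wronskian[OF assms])
  define N where "N = (\<lambda>x. deriv (deriv f) x * g x - f x * deriv (deriv g) x)"
  have dN: "(N has_real_derivative ((deriv ^^ 3) f x * g x - f x * (deriv ^^ 3) g x)
      + (deriv (deriv f) x * deriv g x - deriv f x * deriv (deriv g) x)) (at x)"
    unfolding N_def by (auto intro!: derivative_eq_intros d0 d1 d2)
  have dW: "(wronskian f g has_real_derivative N x) (at x)"
    unfolding wronskian_def[abs_def] N_def by (auto intro!: derivative_eq_intros d0 d1 d2)
  have "((\<lambda>x. N x / wronskian f g x) has_real_derivative
      normalized_det f g 3 x x - (N x / wronskian f g x)\<^sup>2 - Psi f g x) (at x)"
    by (rule DERIV_cong[OF DERIV_divide[OF dN dW W]])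
      (use W in \<open>simp add: normalized_det_def Psi_def field_simps power2_eq_square\<close>)
  then show ?thesis by (simp add: Phi_def[abs_def] N_def)
qed

text \<open>
  Abel's identity: a Wronskian of two solutions of \<open>y'' = P y' + Q y\<close> solves \<open>W' = P W\<close>. Any two
  such functions have a constant quotient if the denominator has no zero.
\<close>

lemma wronskian_quotient_const:
  fixes N W P :: "real \<Rightarrow> real"
  assumes "is_interval J"
    and "\<And>x. x \<in> J \<Longrightarrow> (N has_real_derivative P x * N x) (at x)"
    and "\<And>x. x \<in> J \<Longrightarrow> (W has_real_derivative P x * W x) (at x)"
    and "\<And>x. x \<in> J \<Longrightarrow> W x \<noteq> 0"
  shows "\<exists>c. \<forall>x\<in>J. N x = c * W x"
proof -
  have "\<exists>c. \<forall>x\<in>J. N x / W x = c"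
  proof (rule has_field_derivative_zero_constant)
    show "convex J" using assms(1) by (simp add: is_interval_convex_1)
    fix x assume x: "x \<in> J"
    have "((\<lambda>x. N x / W x) has_real_derivative 0) (at x)"
      by (rule DERIV_cong[OF DERIV_divide[OF assms(2,3,4)[OF x]]]) simp
    then show "((\<lambda>x. N x / W x) has_real_derivative 0) (at x within J)"
      by (rule has_field_derivative_at_within)
  qed
  then show ?thesis using assms(4) by (metis nonzero_divide_eq_eq)
qed

text \<open>
  Cramer's rule writes \<open>y\<close> as a combination of \<open>h\<close> and \<open>k\<close> whose coefficients are quotients of
  Wronskians, hence constant.
\<close>

lemma linear_ode_solution_in_span:
  fixes y y' h h' k k' P Q :: "real \<Rightarrow> real"
  assumes J: "is_interval J"
    and y: "\<And>x. x \<in> J \<Longrightarrow> (y has_real_derivative y' x) (at x)"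
      "\<And>x. x \<in> J \<Longrightarrow> (y' has_real_derivative P x * y' x + Q x * y x) (at x)"
    and h: "\<And>x. x \<in> J \<Longrightarrow> (h has_real_derivative h' x) (at x)"
      "\<And>x. x \<in> J \<Longrightarrow> (h' has_real_derivative P x * h' x + Q x * h x) (at x)"
    and k: "\<And>x. x \<in> J \<Longrightarrow> (k has_real_derivative k' x) (at x)"
      "\<And>x. x \<in> J \<Longrightarrow> (k' has_real_derivative P x * k' x + Q x * k x) (at x)"
    and nz: "\<And>x. x \<in> J \<Longrightarrow> h' x * k x - h x * k' x \<noteq> 0"
  shows "\<exists>a b. \<forall>x\<in>J. y x = a * h x + b * k x"
proof -
  have W: "((\<lambda>x. a' x * b x - a x * b' x) has_real_derivative P x * (a' x * b x - a x * b' x)) (at x)"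
    if "(a has_real_derivative a' x) (at x)" "(a' has_real_derivative P x * a' x + Q x * a x) (at x)"
      "(b has_real_derivative b' x) (at x)" "(b' has_real_derivative P x * b' x + Q x * b x) (at x)"
    for a a' b b' x
    by (rule DERIV_cong[OF DERIV_diff[OF DERIV_mult[OF that(2,3)] DERIV_mult[OF that(1,4)]]])
      (simp add: algebra_simps)
  obtain a where a: "\<And>x. x \<in> J \<Longrightarrow> y' x * k x - y x * k' x = a * (h' x * k x - h x * k' x)"
    using wronskian_quotient_const[OF J W[OF y k] W[OF h k] nz] by blast
  obtain b where b: "\<And>x. x \<in> J \<Longrightarrow> h' x * y x - h x * y' x = b * (h' x * k x - h x * k' x)"
    using wronskian_quotient_const[OF J W[OF h y] W[OF h k] nz] by blast
  have "y x = a * h x + b * k x" if x: "x \<in> J" for x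
  proof -
    have "y x * (h' x * k x - h x * k' x)
        = (y' x * k x - y x * k' x) * h x + (h' x * y x - h x * y' x) * k x"
      by (simp add: algebra_simps)
    also have "\<dots> = (a * h x + b * k x) * (h' x * k x - h x * k' x)"
      unfolding a[OF x] b[OF x] by (simp add: algebra_simps)
    finally show ?thesis using nz[OF x] by simp
  qed
  then show ?thesis by blast
qed

text \<open>
  A singular coefficient matrix would make \<open>\<D>\<^bsub>f,g\<^esub>\<close> vanish identically, contrary to the Chebyshev property.
\<close>

lemma same_span_imp_equivalent:
  assumes "open J" "J \<noteq> {}" "chebyshev_system J f g"
    and f: "\<forall>x\<in>J. f x = a * h x + b * k x" and g: "\<forall>x\<in>J. g x = c * h x + d * k x"
  shows "equivalent_pairs J (f, g) (h, k)"
proof -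
  obtain x where "x \<in> J" using assms(2) by blast
  then obtain e where "e > 0" "cball x e \<subseteq> J"
    using open_contains_cball_eq[OF assms(1)] by blast
  then have "x + e \<in> J" "x \<noteq> x + e" by (auto simp: dist_real_def subset_iff)
  then have "cheb_det f g x (x + e) \<noteq> 0"
    using assms(3) \<open>x \<in> J\<close> unfolding chebyshev_system_def by blast
  moreover have "cheb_det f g x (x + e) = (a * d - b * c) * cheb_det h k x (x + e)"
    using f g \<open>x \<in> J\<close> \<open>x + e \<in> J\<close> by (simp add: cheb_det_def algebra_simps)
  ultimately have "a * d - b * c \<noteq> 0" by auto
  then show ?thesis using f g unfolding equivalent_pairs_def by auto
qed

lemma ode_solutions_equivalent:
  fixes P Q h h' k k' :: "real \<Rightarrow> real"
  assumes J: "open J" "is_interval J" "J \<noteq> {}" and fg: "smooth_chebyshev n J f g" and n: "2 \<le> n"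
    and ode: "\<And>x. x \<in> J \<Longrightarrow> deriv (deriv f) x = P x * deriv f x + Q x * f x"
      "\<And>x. x \<in> J \<Longrightarrow> deriv (deriv g) x = P x * deriv g x + Q x * g x"
    and hk: "\<And>x. x \<in> J \<Longrightarrow> (h has_real_derivative h' x) (at x)"
      "\<And>x. x \<in> J \<Longrightarrow> (h' has_real_derivative P x * h' x + Q x * h x) (at x)"
      "\<And>x. x \<in> J \<Longrightarrow> (k has_real_derivative k' x) (at x)"
      "\<And>x. x \<in> J \<Longrightarrow> (k' has_real_derivative P x * k' x + Q x * k x) (at x)"
      "\<And>x. x \<in> J \<Longrightarrow> h' x * k x - h x * k' x \<noteq> 0"
  shows "equivalent_pairs J (f, g) (h, k)"
proof -
  have d: "(f has_real_derivative deriv f x) (at x)" "(g has_real_derivative deriv g x) (at x)"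
    "(deriv f has_real_derivative P x * deriv f x + Q x * f x) (at x)"
    "(deriv g has_real_derivative P x * deriv g x + Q x * g x) (at x)" if x: "x \<in> J" for x
    using smooth_chebyshev_DERIV[OF fg _ x, of 0] smooth_chebyshev_DERIV[OF fg _ x, of 1] n
    by (auto simp: ode[OF x, symmetric])
  obtain a b where f: "\<forall>x\<in>J. f x = a * h x + b * k x"
    using linear_ode_solution_in_span[OF J(2) d(1,3) hk] by blast
  obtain a' b' where g: "\<forall>x\<in>J. g x = a' * h x + b' * k x"
    using linear_ode_solution_in_span[OF J(2) d(2,4) hk] by blast
  show ?thesis
    by (rule same_span_imp_equivalent[OF J(1,3) smooth_chebyshev_imp_chebyshev[OF fg] f g])
qed

lemma same_invariants_imp_equivalent:
  assumes J: "open J" "is_interval J" "J \<noteq> {}" and fg: "smooth_chebyshev n J f g"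
    and hk: "smooth_chebyshev n J h k" and n: "2 \<le> n"
    and eq: "\<And>x. x \<in> J \<Longrightarrow> Phi f g x = Phi h k x" "\<And>x. x \<in> J \<Longrightarrow> Psi f g x = Psi h k x"
  shows "equivalent_pairs J (f, g) (h, k)"
proof (rule ode_solutions_equivalent[OF J fg n])
  fix x assume x: "x \<in> J"
  note ode = solves_own_ode[OF smooth_chebyshev_wronskian[OF fg x]]
    solves_own_ode[OF smooth_chebyshev_wronskian[OF hk x]]
  show "deriv (deriv f) x = Phi f g x * deriv f x + Psi f g x * f x"
    "deriv (deriv g) x = Phi f g x * deriv g x + Psi f g x * g x"
    by (rule ode)+
  show "(h has_real_derivative deriv h x) (at x)" "(k has_real_derivative deriv k x) (at x)"
    "(deriv h has_real_derivative Phi f g x * deriv h x + Psi f g x * h x) (at x)"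
    "(deriv k has_real_derivative Phi f g x * deriv k x + Psi f g x * k x) (at x)"
    using smooth_chebyshev_DERIV[OF hk _ x, of 0] smooth_chebyshev_DERIV[OF hk _ x, of 1] n
    by (auto simp: eq[OF x] ode(3,4)[symmetric])
  show "deriv h x * k x - h x * deriv k x \<noteq> 0"
    using smooth_chebyshev_wronskian[OF hk x] by (simp add: wronskian_def)
qed

section \<open>Equal means have equal invariants\<close>

lemma (in prob_space) second_moment_nonzero:
  fixes Z :: "'a \<Rightarrow> real"
  assumes "Z \<in> borel_measurable M" "\<And>t. t \<in> space M \<Longrightarrow> \<bar>Z t\<bar> \<le> B" "(\<integral>t. Z t ^ 3 \<partial>M) \<noteq> 0"
  shows "(\<integral>t. Z t ^ 2 \<partial>M) \<noteq> 0"
proof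
  assume "(\<integral>t. Z t ^ 2 \<partial>M) = 0"
  moreover have "integrable M (\<lambda>t. Z t ^ 2)"
  proof (rule integrable_const_bound[where B = "B ^ 2"])
    show "AE t in M. norm (Z t ^ 2) \<le> B ^ 2"
      by (rule AE_I2) (unfold real_norm_def power_abs, intro power_mono assms(2), auto)
  qed (use assms(1) in measurable)
  ultimately have "AE t in M. Z t ^ 2 = 0"
    by (simp add: integral_nonneg_eq_0_iff_AE)
  then have "AE t in M. Z t ^ 3 = 0" by (rule AE_mp) simp
  from integral_eq_zero_AE[OF this] show False using assms(3) by simp
qed

text \<open>
  Some directional derivative of the family at the diagonal point \<open>(x, ..., x)\<close> has a nonzero third central
  moment. The central moment of order two is then nonzero as well, so that both coefficients of the
  comparison below can be read off along this one direction.
\<close>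

definition skew_at :: "'t measure \<Rightarrow> (real ^ 'n::finite \<Rightarrow> 't \<Rightarrow> real) \<Rightarrow> real \<Rightarrow> bool"
  where "skew_at \<mu> m x \<longleftrightarrow> (\<exists>v D.
    (\<forall>t\<in>space \<mu>. ((\<lambda>s. m (vec x + s *\<^sub>R v) t) has_real_derivative D t) (at 0)) \<and>
    (\<integral>t. (D t - (\<integral>t. D t \<partial>\<mu>)) ^ 3 \<partial>\<mu>) \<noteq> 0)"

context interval_means
begin

lemma near_diagonal:
  fixes x :: "real ^ 'n"
  assumes "\<And>i. \<bar>x $ i - x0\<bar> \<le> r" "y \<in> {Min (range (($) x))..Max (range (($) x))}"
  shows "\<bar>y - x0\<bar> \<le> r"
proof -
  have *: "x0 - r \<le> x $ i \<and> x $ i \<le> x0 + r" for i using assms(1)[of i] by linarith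
  then have "x0 - r \<le> Min (range (($) x))" by (intro Min.boundedI) auto
  moreover have "Max (range (($) x)) \<le> x0 + r" by (intro Max.boundedI) (use * in auto)
  ultimately show ?thesis using assms(2) unfolding atLeastAtMost_iff by linarith
qed

text \<open>
  A mean at \<open>(x\<^sub>0, ..., x\<^sub>0) + s v\<close> differs from \<open>x\<^sub>0\<close> by at most \<open>s\<close> times a constant, merely because it lies
  between the coordinates. This bound is uniform in \<open>t\<close> and dominates the difference quotients in
  the passages to the limit below.
\<close>

lemma approach_diagonal:
  fixes v :: "real ^ 'n"
  assumes "x0 \<in> I"
  obtains s :: "nat \<Rightarrow> real" and K where "\<And>n. s n > 0" "s \<longlonglongrightarrow> 0"
    "\<And>n. vec x0 + s n *\<^sub>R v \<in> cube I"
    "\<And>n y. y \<in> {Min (range (($) (vec x0 + s n *\<^sub>R v)))..Max (range (($) (vec x0 + s n *\<^sub>R v)))}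
      \<Longrightarrow> \<bar>y - x0\<bar> \<le> K * s n"
    "\<And>t D. t \<in> space \<mu> \<Longrightarrow> ((\<lambda>s. m (vec x0 + s *\<^sub>R v) t) has_real_derivative D) (at 0) \<Longrightarrow>
      (\<lambda>n. (m (vec x0 + s n *\<^sub>R v) t - x0) / s n) \<longlonglongrightarrow> D"
proof -
  obtain e where e: "e > 0" "cball x0 e \<subseteq> I"
    using open_contains_cball_eq[OF open_I] assms by blast
  define K where "K = norm v + 1"
  have K: "K > 0" by (simp add: K_def add_nonneg_pos)
  define s where "s = (\<lambda>n. (e / K) * inverse (real (Suc n)))"
  have pos: "s n > 0" for n using e K by (simp add: s_def)
  have lim: "s \<longlonglongrightarrow> 0"
    unfolding s_def using tendsto_mult_right_zero[OF LIMSEQ_inverse_real_of_nat] .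
  have coord: "\<bar>(vec x0 + s n *\<^sub>R v) $ i - x0\<bar> \<le> K * s n" for n i
  proof -
    have "\<bar>v $ i\<bar> \<le> K" using component_le_norm_cart[of v i] by (simp add: K_def)
    then have "s n * \<bar>v $ i\<bar> \<le> s n * K" using pos[of n] by (intro mult_left_mono) auto
    then show ?thesis using pos[of n] by (simp add: abs_mult mult.commute)
  qed
  have "K * s n \<le> e" for n
  proof -
    have "K * s n = e * inverse (real (Suc n))" using K by (simp add: s_def)
    also have "\<dots> \<le> e * 1" using e by (intro mult_left_mono) (auto simp: inverse_le_1_iff)
    finally show ?thesis by simp
  qed
  then have "(vec x0 + s n *\<^sub>R v) $ i \<in> cball x0 e" for n i
    using order_trans[OF coord] by (simp add: dist_real_def abs_minus_commute)
  then have mem: "vec x0 + s n *\<^sub>R v \<in> cube I" for n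
    unfolding cube_def using e(2) by blast
  have "vec x0 \<in> cube I" using assms by (simp add: cube_def)
  then have diag: "m (vec x0) t = x0" if "t \<in> space \<mu>" for t
  proof -
    have "\<bar>m (vec x0) t - x0\<bar> \<le> 0"
      by (rule near_diagonal[OF _ mean_values(2)[OF \<open>vec x0 \<in> cube I\<close> that]]) simp
    then show ?thesis by simp
  qed
  have quot: "(\<lambda>n. (m (vec x0 + s n *\<^sub>R v) t - x0) / s n) \<longlonglongrightarrow> D"
    if t: "t \<in> space \<mu>" and D: "((\<lambda>s. m (vec x0 + s *\<^sub>R v) t) has_real_derivative D) (at 0)" for t D
  proof -
    have "filterlim s (at 0) sequentially"
      unfolding filterlim_at using lim pos by (auto simp: less_imp_neq[OF pos, symmetric])
    from filterlim_compose[OF D[unfolded DERIV_def] this]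
    show ?thesis by (simp add: diag[OF t])
  qed
  show ?thesis
    by (rule that[OF pos lim mem near_diagonal[OF coord] quot])
qed

lemma diagonal_derivative_bounded:
  fixes v :: "real ^ 'n"
  assumes x0: "x0 \<in> I"
    and D: "\<And>t. t \<in> space \<mu> \<Longrightarrow> ((\<lambda>s. m (vec x0 + s *\<^sub>R v) t) has_real_derivative D t) (at 0)"
  shows "D \<in> borel_measurable \<mu> \<and> (\<exists>B. \<forall>t\<in>space \<mu>. \<bar>D t\<bar> \<le> B)"
proof -
  obtain s K where s: "\<And>n. s n > 0" "s \<longlonglongrightarrow> 0"
    and mem: "\<And>n. vec x0 + s n *\<^sub>R v \<in> cube I"
    and near: "\<And>n y. y \<in> {Min (range (($) (vec x0 + s n *\<^sub>R v)))..Max (range (($) (vec x0 + s n *\<^sub>R v)))}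
      \<Longrightarrow> \<bar>y - x0\<bar> \<le> K * s n"
    and quot: "\<And>t D. t \<in> space \<mu> \<Longrightarrow> ((\<lambda>s. m (vec x0 + s *\<^sub>R v) t) has_real_derivative D) (at 0) \<Longrightarrow>
      (\<lambda>n. (m (vec x0 + s n *\<^sub>R v) t - x0) / s n) \<longlonglongrightarrow> D"
    using approach_diagonal[OF x0, of v] by blast
  have lim: "(\<lambda>n. (m (vec x0 + s n *\<^sub>R v) t - x0) / s n) \<longlonglongrightarrow> D t" if "t \<in> space \<mu>" for t
    by (rule quot[OF that D[OF that]])
  have "D \<in> borel_measurable \<mu>"
    by (rule borel_measurable_LIMSEQ_real[OF lim]) (use mean_values(1)[OF mem] in measurable)
  moreover have "\<bar>D t\<bar> \<le> K" if t: "t \<in> space \<mu>" for t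
  proof (rule LIMSEQ_le_const2[OF tendsto_rabs[OF lim[OF t]]], intro exI allI impI)
    fix n show "\<bar>(m (vec x0 + s n *\<^sub>R v) t - x0) / s n\<bar> \<le> K"
      using near[OF mean_values(2)[OF mem t], of n] s(1)[of n] by (simp add: field_simps)
  qed
  ultimately show ?thesis by blast
qed

text \<open>
  The points \<open>(x\<^sub>0, ..., x\<^sub>0) + s\<^sub>n v\<close> put the values of the family and of the generated mean into the
  situation of \<open>scaled_moment_coefficient_eq_0\<close>; the function with leading term \<open>u - w\<close> is the
  normalized determinant of \<open>(f, g)\<close> itself.
\<close>

lemma leading_coefficient_eq_0:
  fixes v :: "real ^ 'n"
  assumes fg: "smooth_chebyshev 3 I f g" and x0: "x0 \<in> I"
    and D: "\<And>t. t \<in> space \<mu> \<Longrightarrow> ((\<lambda>s. m (vec x0 + s *\<^sub>R v) t) has_real_derivative D t) (at 0)"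
    and nz: "(\<integral>t. (D t - (\<integral>t. D t \<partial>\<mu>)) ^ 3 \<partial>\<mu>) \<noteq> 0"
    and \<delta>: "\<And>e. e > 0 \<Longrightarrow> \<exists>d>0. \<forall>u\<in>I. \<forall>w\<in>I. \<bar>u - x0\<bar> < d \<longrightarrow> \<bar>w - x0\<bar> < d \<longrightarrow>
      \<bar>\<delta> u w - R * (u - w) ^ k\<bar> \<le> e * \<bar>u - w\<bar> ^ k"
    and k: "k \<in> {2, 3}"
    and int: "\<And>x. x \<in> cube I \<Longrightarrow> integrable \<mu> (\<lambda>t. \<delta> (m x t) (gen_mean I f g m \<mu> x))"
      "\<And>x. x \<in> cube I \<Longrightarrow> (\<integral>t. \<delta> (m x t) (gen_mean I f g m \<mu> x) \<partial>\<mu>) = 0"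
  shows "R = 0"
proof -
  note cheb = smooth_chebyshev_imp_chebyshev[OF fg]
  obtain s K where s: "\<And>n. s n > 0" "s \<longlonglongrightarrow> 0"
    and mem: "\<And>n. vec x0 + s n *\<^sub>R v \<in> cube I"
    and near: "\<And>n y. y \<in> {Min (range (($) (vec x0 + s n *\<^sub>R v)))..Max (range (($) (vec x0 + s n *\<^sub>R v)))}
      \<Longrightarrow> \<bar>y - x0\<bar> \<le> K * s n"
    and quot: "\<And>t D. t \<in> space \<mu> \<Longrightarrow> ((\<lambda>s. m (vec x0 + s *\<^sub>R v) t) has_real_derivative D) (at 0) \<Longrightarrow>
      (\<lambda>n. (m (vec x0 + s n *\<^sub>R v) t - x0) / s n) \<longlonglongrightarrow> D"
    using approach_diagonal[OF x0, of v] by blast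
  define X where "X = (\<lambda>n. m (vec x0 + s n *\<^sub>R v))"
  define y where "y = (\<lambda>n. gen_mean I f g m \<mu> (vec x0 + s n *\<^sub>R v))"
  have X: "X n \<in> borel_measurable \<mu>" "t \<in> space \<mu> \<Longrightarrow> X n t \<in> I" "t \<in> space \<mu> \<Longrightarrow> \<bar>X n t - x0\<bar> \<le> K * s n" for n t
    unfolding X_def using mean_values(1)[OF mem] mean_mem[OF mem] near mean_values(2)[OF mem] by blast+
  have y: "y n \<in> I" "\<bar>y n - x0\<bar> \<le> K * s n" for n
    unfolding y_def using gen_mean_mem[OF cheb mem] near gen_mean_between[OF cheb mem] by blast+
  have lim: "(\<lambda>n. (X n t - x0) / s n) \<longlonglongrightarrow> D t" if "t \<in> space \<mu>" for t
    unfolding X_def by (rule quot[OF that D[OF that]])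
  obtain B where D_meas: "D \<in> borel_measurable \<mu>" and D_le: "\<And>t. t \<in> space \<mu> \<Longrightarrow> \<bar>D t\<bar> \<le> B"
    using diagonal_derivative_bounded[OF x0 D] by blast
  have nz_k: "(\<integral>t. (D t - (\<integral>t. D t \<partial>\<mu>)) ^ k \<partial>\<mu>) \<noteq> 0"
  proof (cases "k = 3")
    case False
    have "(\<integral>t. (D t - (\<integral>t. D t \<partial>\<mu>)) ^ 2 \<partial>\<mu>) \<noteq> 0"
    proof (rule second_moment_nonzero[OF _ _ nz])
      show "\<bar>D t - (\<integral>t. D t \<partial>\<mu>)\<bar> \<le> B + \<bar>\<integral>t. D t \<partial>\<mu>\<bar>" if "t \<in> space \<mu>" for t
        using D_le[OF that] by linarith
    qed (use D_meas in measurable)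
    then show ?thesis using False k by auto
  qed (use nz in simp)
  let ?\<epsilon> = "normalized_det f g 0"
  have \<epsilon>: "\<exists>d>0. \<forall>u\<in>I. \<forall>w\<in>I. \<bar>u - x0\<bar> < d \<longrightarrow> \<bar>w - x0\<bar> < d \<longrightarrow>
      \<bar>?\<epsilon> u w - 1 * (u - w) ^ 1\<bar> \<le> e * \<bar>u - w\<bar> ^ 1" if e: "e > 0" for e
  proof -
    have one: "normalized_det f g 1 x0 x0 = 1"
      by (rule normalized_det_diagonal(2)[OF smooth_chebyshev_wronskian[OF fg x0]])
    have "\<exists>d>0. \<forall>u\<in>I. \<forall>w\<in>I. \<bar>u - x0\<bar> < d \<longrightarrow> \<bar>w - x0\<bar> < d \<longrightarrow>
      \<bar>?\<epsilon> u w - normalized_det f g 1 x0 x0 / fact 1 * (u - w) ^ 1\<bar> \<le> e * \<bar>u - w\<bar> ^ 1"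
      by (rule uniform_taylor[OF interval_I x0 _ _ _ _ e])
        (auto intro!: DERIV_normalized_det[OF fg] continuous_on_normalized_det[OF fg] simp: normalized_det_diagonal simp del: One_nat_def)
    then show ?thesis by (simp only: one fact_1 div_by_1)
  qed
  have int_\<epsilon>: "integrable \<mu> (\<lambda>t. ?\<epsilon> (X n t) (y n))" "(\<integral>t. ?\<epsilon> (X n t) (y n) \<partial>\<mu>) = 0" for n
    unfolding normalized_det_0 X_def y_def
    using integrable_det[OF cheb mem] gen_mean_zero[OF cheb mem] by simp_all
  have int_\<delta>: "integrable \<mu> (\<lambda>t. \<delta> (X n t) (y n))" "(\<integral>t. \<delta> (X n t) (y n) \<partial>\<mu>) = 0" for n
    unfolding X_def y_def by (rule int[OF mem])+
  show "R = 0"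
    by (rule scaled_moment_coefficient_eq_0[OF \<epsilon> \<delta> s X y int_\<epsilon> int_\<delta> lim nz_k])
qed

text \<open>
  Let \<open>G\<close> be the difference of the two normalized determinants; its integral vanishes at the common mean.
  On the diagonal its derivatives of order \<open>0\<close> and \<open>1\<close> vanish and the second is the difference of
  the two functions \<open>\<Phi>\<close>, which is therefore \<open>0\<close>. The third-order step needs this at all points near
  \<open>x\<close>, because the centre of the expansion is the moving value of the mean; that is why skewness
  is assumed on the whole interval.
\<close>

lemma same_means_imp_same_invariants:
  assumes fg: "smooth_chebyshev 3 I f g" and hk: "smooth_chebyshev 3 I h k"
    and same: "\<And>x. x \<in> cube I \<Longrightarrow> gen_mean I f g m \<mu> x = gen_mean I h k m \<mu> x"
    and skew: "\<And>x. x \<in> I \<Longrightarrow> skew_at \<mu> m x"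
    and x: "x \<in> I"
  shows "Phi f g x = Phi h k x" and "Psi f g x = Psi h k x"
proof -
  define G where "G = (\<lambda>j u w. normalized_det f g j u w - normalized_det h k j u w)"
  note cheb = smooth_chebyshev_imp_chebyshev[OF fg] smooth_chebyshev_imp_chebyshev[OF hk]
  have der: "((\<lambda>u. G j u w) has_real_derivative G (Suc j) u w) (at u)" if "j < 3" "u \<in> I" for j u w
    unfolding G_def by (intro DERIV_diff DERIV_normalized_det[OF fg] DERIV_normalized_det[OF hk] that)
  have cont: "continuous_on (I \<times> I) (\<lambda>p. G j (fst p) (snd p))" if "j \<le> 3" for j
    unfolding G_def using that
    by (intro continuous_on_diff continuous_on_normalized_det[OF fg] continuous_on_normalized_det[OF hk]) auto
  have G01: "G j w w = 0" if "j < 2" "w \<in> I" for j w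
  proof -
    have "j = 0 \<or> j = 1" using that by auto
    then show ?thesis
      using smooth_chebyshev_wronskian[OF fg that(2)] smooth_chebyshev_wronskian[OF hk that(2)]
      by (auto simp: G_def normalized_det_diagonal simp del: One_nat_def)
  qed
  have int: "integrable \<mu> (\<lambda>t. G 0 (m x t) (gen_mean I f g m \<mu> x))"
    "(\<integral>t. G 0 (m x t) (gen_mean I f g m \<mu> x) \<partial>\<mu>) = 0" if "x \<in> cube I" for x
    unfolding G_def normalized_det_0
    using integrable_det[OF cheb(1) that] integrable_det[OF cheb(2) that]
      gen_mean_zero[OF cheb(1) that] gen_mean_zero[OF cheb(2) that] same[OF that] by simp_all
  have coeff: "G j z z = 0" if z: "z \<in> I" and j: "j \<in> {2, 3}"
    and zero: "\<And>i w. i < j \<Longrightarrow> w \<in> I \<Longrightarrow> G i w w = 0" for j z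
  proof -
    obtain v D where D: "\<And>t. t \<in> space \<mu> \<Longrightarrow> ((\<lambda>s. m (vec z + s *\<^sub>R v) t) has_real_derivative D t) (at 0)"
      and nz: "(\<integral>t. (D t - (\<integral>t. D t \<partial>\<mu>)) ^ 3 \<partial>\<mu>) \<noteq> 0"
      using skew[OF z] unfolding skew_at_def by blast
    have "j > 0" "j \<le> 3" using j by auto
    have "G j z z / fact j = 0"
    proof (rule leading_coefficient_eq_0[OF fg z D nz _ j int])
      fix e :: real assume "e > 0"
      then show "\<exists>d>0. \<forall>u\<in>I. \<forall>w\<in>I. \<bar>u - z\<bar> < d \<longrightarrow> \<bar>w - z\<bar> < d \<longrightarrow>
          \<bar>G 0 u w - G j z z / fact j * (u - w) ^ j\<bar> \<le> e * \<bar>u - w\<bar> ^ j"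
        using \<open>j > 0\<close> \<open>j \<le> 3\<close> by (intro uniform_taylor interval_I z zero cont) (auto intro!: der)
    qed auto
    then show ?thesis by simp
  qed
  have G2: "G 2 z z = 0" if "z \<in> I" for z
    by (rule coeff[OF that]) (auto intro: G01)
  then have Phi: "Phi f g z = Phi h k z" if "z \<in> I" for z
    using that by (simp add: G_def normalized_det_diagonal(3))
  have "G 3 x x = 0"
  proof (rule coeff[OF x])
    fix i w assume i: "i < (3::nat)" and w: "w \<in> I"
    have "i = 2 \<or> i < 2" using i by auto
    then show "G i w w = 0" using G01 G2 w by blast
  qed simp
  moreover have "(Phi h k has_real_derivative normalized_det f g 3 x x - (Phi f g x)\<^sup>2 - Psi f g x) (at x)"
    by (rule has_field_derivative_transform_within_open[OF DERIV_Phi[OF fg x] open_I x Phi])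
  from DERIV_unique[OF this DERIV_Phi[OF hk x]]
  have "normalized_det f g 3 x x - (Phi f g x)\<^sup>2 - Psi f g x
    = normalized_det h k 3 x x - (Phi h k x)\<^sup>2 - Psi h k x" .
  ultimately show "Psi f g x = Psi h k x"
    using Phi[OF x] by (simp add: G_def)
  show "Phi f g x = Phi h k x" by (rule Phi[OF x])
qed

text \<open>
  First-order derivatives of a homogeneous function of degree one are homogeneous of degree zero, so
  the directional derivatives along \<open>v\<close> at two diagonal points coincide as functions of \<open>t\<close>.
\<close>

lemma skew_at_homogeneous:
  assumes pos: "I \<subseteq> {0<..}" and hom: "homogeneous_family I \<mu> m"
    and x0: "x0 \<in> I" and x: "x \<in> I" and skew: "skew_at \<mu> m x0"
  shows "skew_at \<mu> m x"
proof -
  obtain v D where D: "\<And>t. t \<in> space \<mu> \<Longrightarrow> ((\<lambda>s. m (vec x0 + s *\<^sub>R v) t) has_real_derivative D t) (at 0)"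
    and nz: "(\<integral>t. (D t - (\<integral>t. D t \<partial>\<mu>)) ^ 3 \<partial>\<mu>) \<noteq> 0"
    using skew unfolding skew_at_def by blast
  \<comment> \<open>the ratio that moves the diagonal point over \<open>x0\<close> to the one over \<open>x\<close>\<close>
  define c where "c = x / x0"
  have x0p: "x0 > 0" using pos x0 by auto
  have c: "c \<in> ratio_set I" unfolding c_def ratio_set_def using x x0 by blast
  have c0: "c > 0" by (rule ratio_set_pos[OF pos c])
  have cx0: "c * x0 = x" using x0p by (simp add: c_def)
  \<comment> \<open>the parameters for which both the point on the ray and its multiple by \<open>c\<close> stay in the cube\<close>
  define S where "S = (\<Inter>i. (\<lambda>s. x0 + s / c * v $ i) -` scaled_inter I c)"
  have S: "open S"
    unfolding S_def by (intro open_INT open_vimage ballI open_scaled_inter[OF c0 open_I] continuous_intros) (use c0 in auto)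
  have S0: "0 \<in> S" using x0 x by (simp add: S_def scaled_inter_iff[OF c0] cx0)
  have "((\<lambda>s. m (vec x + s *\<^sub>R v) t) has_real_derivative D t) (at 0)" if t: "t \<in> space \<mu>" for t
  proof (rule has_field_derivative_transform_within_open[OF _ S S0])
    have "((\<lambda>s. m (vec x0 + (s / c) *\<^sub>R v) t) has_real_derivative D t * (1 / c)) (at 0)"
      by (rule DERIV_chain2[where f = "\<lambda>s. m (vec x0 + s *\<^sub>R v) t" and g = "\<lambda>s. s / c"])
        (use D[OF t] in \<open>auto intro: DERIV_cdivide[OF DERIV_ident]\<close>)
    from DERIV_cmult[OF this, of c]
    show "((\<lambda>s. c * m (vec x0 + (s / c) *\<^sub>R v) t) has_real_derivative D t) (at 0)"
      using c0 by simp
    fix s assume "s \<in> S"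
    then have "vec x0 + (s / c) *\<^sub>R v \<in> cube (scaled_inter I c)"
      by (auto simp: S_def cube_def)
    moreover have "c *\<^sub>R (vec x0 + (s / c) *\<^sub>R v) = vec x + s *\<^sub>R v"
      using c0 by (simp add: vec_eq_iff algebra_simps flip: cx0)
    ultimately show "c * m (vec x0 + (s / c) *\<^sub>R v) t = m (vec x + s *\<^sub>R v) t"
      using hom t c unfolding homogeneous_family_def homogeneous_on_def by metis
  qed
  then show ?thesis using nz unfolding skew_at_def by blast
qed

end

section \<open>Skewness from the third central moments of the partial derivatives\<close>

lemma open_cube:
  assumes "open I"
  shows "open (cube I :: (real ^ 'n::finite) set)"
proof -
  have "cube I = (\<Inter>i. (\<lambda>x :: real ^ 'n. x $ i) -` I)" by (auto simp: cube_def)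
  then show ?thesis using assms by (auto intro!: open_INT open_vimage continuous_intros)
qed

text \<open>
  The coordinates are added one at a time. The increment contributed by the \<open>j\<close>-th coordinate is
  compared with the linear function \<open>\<rho> \<partial>\<^sub>j\<phi>(p)\<close> on a segment near \<open>p\<close>, where \<open>\<partial>\<^sub>j\<phi>\<close> is almost constant.
\<close>

lemma directional_derivative_of_continuous_partials:
  fixes \<phi> :: "real ^ 'n::finite \<Rightarrow> real"
  assumes U: "open U" "p \<in> U"
    and part: "\<And>i x. x \<in> U \<Longrightarrow> has_partial_deriv i \<phi> x"
    and cont: "\<And>i. continuous_on U (partial_deriv i \<phi>)"
  shows "((\<lambda>s. \<phi> (p + s *\<^sub>R v)) has_real_derivative (\<Sum>i\<in>UNIV. v $ i * partial_deriv i \<phi> p)) (at 0)"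
proof -
  have shift: "((\<lambda>r. \<phi> (q + r *\<^sub>R axis j 1)) has_real_derivative partial_deriv j \<phi> (q + r *\<^sub>R axis j 1)) (at r)"
    if "q + r *\<^sub>R axis j 1 \<in> U" for q j r
  proof -
    have "((\<lambda>s. \<phi> (q + r *\<^sub>R axis j 1 + s *\<^sub>R axis j 1)) has_real_derivative
        partial_deriv j \<phi> (q + r *\<^sub>R axis j 1)) (at 0)"
      using part[OF that, of j] unfolding has_partial_deriv_def partial_deriv_def
      by (simp add: DERIV_deriv_iff_real_differentiable)
    then show ?thesis
      using DERIV_shift[of "\<lambda>r. \<phi> (q + r *\<^sub>R axis j 1)" "partial_deriv j \<phi> (q + r *\<^sub>R axis j 1)" 0 r]
      by (simp add: algebra_simps)
  qed
  have step: "((\<lambda>s. \<phi> (p + s *\<^sub>R (b *\<^sub>R axis j 1 + w)) - \<phi> (p + s *\<^sub>R w)) has_real_derivative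
      b * partial_deriv j \<phi> p) (at 0)" for b j w
    unfolding DERIV_def
  proof (rule LIM_I)
    fix r :: real assume r: "r > 0"
    define e where "e = r / (\<bar>b\<bar> + 1)"
    have e: "e > 0" using r by (simp add: e_def)
    have er: "e * \<bar>b\<bar> < r" using r by (simp add: e_def field_simps)
    obtain d1 where d1: "d1 > 0" "ball p d1 \<subseteq> U"
      using U open_contains_ball by blast
    obtain d2 where d2: "d2 > 0" "\<And>x. x \<in> U \<Longrightarrow> dist x p < d2 \<Longrightarrow> dist (partial_deriv j \<phi> x) (partial_deriv j \<phi> p) < e"
      using cont[of j] U(2) e unfolding continuous_on_iff by metis
    define d where "d = min d1 d2 / (\<bar>b\<bar> + norm w + 1)"
    have den: "\<bar>b\<bar> + norm w + 1 > 0" by (simp add: add_nonneg_pos)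
    have d: "d > 0" using d1(1) d2(1) den by (simp add: d_def)
    have "\<bar>(\<phi> (p + s *\<^sub>R (b *\<^sub>R axis j 1 + w)) - \<phi> (p + s *\<^sub>R w)) / s - b * partial_deriv j \<phi> p\<bar> < r"
      if s: "s \<noteq> 0" "\<bar>s\<bar> < d" for s
    proof -
      define \<psi> where "\<psi> = (\<lambda>\<rho>. \<phi> ((p + s *\<^sub>R w) + \<rho> *\<^sub>R axis j 1) - \<rho> * partial_deriv j \<phi> p)"
      have near: "dist ((p + s *\<^sub>R w) + \<rho> *\<^sub>R axis j 1) p < min d1 d2" if "\<rho> \<in> closed_segment 0 (s * b)" for \<rho>
      proof -
        have "\<bar>\<rho>\<bar> \<le> \<bar>s * b\<bar>"
          using that by (auto simp: closed_segment_eq_real_ivl split: if_splits)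
        moreover have "dist ((p + s *\<^sub>R w) + \<rho> *\<^sub>R axis j 1) p \<le> \<bar>s\<bar> * norm w + \<bar>\<rho>\<bar>"
          using norm_triangle_ineq[of "s *\<^sub>R w" "\<rho> *\<^sub>R axis j (1::real)"]
          by (simp add: dist_norm algebra_simps)
        ultimately have "dist ((p + s *\<^sub>R w) + \<rho> *\<^sub>R axis j 1) p \<le> \<bar>s\<bar> * (\<bar>b\<bar> + norm w)"
          by (simp add: abs_mult algebra_simps)
        also have "\<dots> \<le> \<bar>s\<bar> * (\<bar>b\<bar> + norm w + 1)" by (intro mult_left_mono) auto
        also have "\<dots> < d * (\<bar>b\<bar> + norm w + 1)" using s(2) den by (intro mult_strict_right_mono)
        also have "\<dots> = min d1 d2" using den by (simp add: d_def)
        finally show ?thesis .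
      qed
      have "norm (\<psi> (s * b) - \<psi> 0) \<le> e * norm (s * b - 0)"
      proof (rule field_differentiable_bound[OF convex_closed_segment])
        fix \<rho> assume \<rho>: "\<rho> \<in> closed_segment 0 (s * b)"
        let ?q = "(p + s *\<^sub>R w) + \<rho> *\<^sub>R axis j 1"
        have q: "?q \<in> U" using near[OF \<rho>] d1(2) by (auto simp: dist_commute)
        have "(\<psi> has_real_derivative partial_deriv j \<phi> ?q - partial_deriv j \<phi> p) (at \<rho>)"
          unfolding \<psi>_def by (rule DERIV_cong[OF DERIV_diff[OF shift[OF q] DERIV_cmult_right[OF DERIV_ident]]]) simp
        then show "(\<psi> has_field_derivative partial_deriv j \<phi> ?q - partial_deriv j \<phi> p)
            (at \<rho> within closed_segment 0 (s * b))" by (rule has_field_derivative_at_within)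
        show "norm (partial_deriv j \<phi> ?q - partial_deriv j \<phi> p) \<le> e"
          using d2(2)[OF q] near[OF \<rho>] by (simp add: dist_norm)
      qed auto
      moreover have "\<psi> (s * b) - \<psi> 0
          = \<phi> (p + s *\<^sub>R (b *\<^sub>R axis j 1 + w)) - \<phi> (p + s *\<^sub>R w) - s * (b * partial_deriv j \<phi> p)"
        by (simp add: \<psi>_def algebra_simps)
      ultimately have "\<bar>\<phi> (p + s *\<^sub>R (b *\<^sub>R axis j 1 + w)) - \<phi> (p + s *\<^sub>R w) - s * (b * partial_deriv j \<phi> p)\<bar>
          \<le> \<bar>s\<bar> * (e * \<bar>b\<bar>)"
        by (simp add: abs_mult algebra_simps)
      moreover have "(\<phi> (p + s *\<^sub>R (b *\<^sub>R axis j 1 + w)) - \<phi> (p + s *\<^sub>R w)) / s - b * partial_deriv j \<phi> p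
          = (\<phi> (p + s *\<^sub>R (b *\<^sub>R axis j 1 + w)) - \<phi> (p + s *\<^sub>R w) - s * (b * partial_deriv j \<phi> p)) / s"
        using s(1) by (simp add: diff_divide_distrib)
      ultimately have "\<bar>(\<phi> (p + s *\<^sub>R (b *\<^sub>R axis j 1 + w)) - \<phi> (p + s *\<^sub>R w)) / s - b * partial_deriv j \<phi> p\<bar>
          \<le> e * \<bar>b\<bar>"
        using s(1) by (simp add: abs_divide divide_le_eq mult.commute)
      then show ?thesis using er by linarith
    qed
    then show "\<exists>d>0. \<forall>s. s \<noteq> 0 \<and> norm (s - 0) < d \<longrightarrow>
        norm ((\<phi> (p + (0 + s) *\<^sub>R (b *\<^sub>R axis j 1 + w)) - \<phi> (p + (0 + s) *\<^sub>R w)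
          - (\<phi> (p + 0 *\<^sub>R (b *\<^sub>R axis j 1 + w)) - \<phi> (p + 0 *\<^sub>R w))) / s - b * partial_deriv j \<phi> p) < r"
      using d by (intro exI[of _ d]) simp
  qed
  have "((\<lambda>s. \<phi> (p + s *\<^sub>R (\<Sum>i\<in>A. v $ i *\<^sub>R axis i 1))) has_real_derivative
      (\<Sum>i\<in>A. v $ i * partial_deriv i \<phi> p)) (at 0)" if "finite A" for A
    using that
  proof (induction A)
    case (insert j A)
    from DERIV_add[OF step[of "v $ j" j "\<Sum>i\<in>A. v $ i *\<^sub>R axis i 1"] insert.IH] insert.hyps
    show ?case by simp
  qed simp
  from this[of UNIV] show ?thesis
    by (simp add: basis_expansion flip: scalar_mult_eq_scaleR)
qed

text \<open>
  Polarization: \<open>24 xyz = (x + y + z)\<^sup>3 - (x + y - z)\<^sup>3 - (x - y + z)\<^sup>3 - (- x + y + z)\<^sup>3\<close>. If the mixed moment is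
  nonzero, then so is the third central moment along one of the four directions
  \<open>\<plusminus>e\<^sub>i \<plusminus> e\<^sub>j \<plusminus> e\<^sub>l\<close> that occur.
\<close>

lemma (in interval_means) third_central_moment_imp_skew_at:
  assumes C1: "C1_family I \<mu> m" and x0: "x0 \<in> I"
    and nz: "avg \<mu> (\<lambda>x t. centered_partial \<mu> i m x t * centered_partial \<mu> j m x t
      * centered_partial \<mu> l m x t) (vec x0) \<noteq> 0"
  shows "skew_at \<mu> m x0"
proof (rule ccontr)
  assume no: "\<not> skew_at \<mu> m x0"
  define F where "F = (\<lambda>r t. fam_partial [r] m (vec x0) t)"
  define X where "X = (\<lambda>r t. F r t - (\<integral>t. F r t \<partial>\<mu>))"
  have vec: "vec x0 \<in> (cube I :: (real ^ 'n) set)" using x0 by (simp add: cube_def)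
  have D: "((\<lambda>s. m (vec x0 + s *\<^sub>R v) t) has_real_derivative (\<Sum>r\<in>UNIV. v $ r * F r t)) (at 0)"
    if t: "t \<in> space \<mu>" for v t
  proof -
    have C: "cont_partial_diff_on 1 (cube I) (\<lambda>x. m x t)" using C1 t by (simp add: C1_family_def)
    have "((\<lambda>s. m (vec x0 + s *\<^sub>R v) t) has_real_derivative
        (\<Sum>r\<in>UNIV. v $ r * partial_deriv r (\<lambda>x. m x t) (vec x0))) (at 0)"
    proof (rule directional_derivative_of_continuous_partials[OF open_cube[OF open_I] vec])
      show "has_partial_deriv r (\<lambda>x. m x t) x" if "x \<in> cube I" for r x
        using C that unfolding cont_partial_diff_on_def partial_derivs_def
        by (auto dest!: conjunct1 spec[of _ "[]"])
      show "continuous_on (cube I) (partial_deriv r (\<lambda>x. m x t))" for r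
        using C unfolding cont_partial_diff_on_def partial_derivs_def
        by (auto dest!: conjunct2 spec[of _ "[r]"])
    qed
    then show ?thesis by (simp add: F_def fam_partial_def partial_derivs_def)
  qed
  have F_meas: "F r \<in> borel_measurable \<mu>" and F_bd: "\<exists>B. \<forall>t\<in>space \<mu>. \<bar>F r t\<bar> \<le> B" for r
  proof -
    have "(\<Sum>r'\<in>UNIV. axis r 1 $ r' * F r' t) = F r t" for t
      by (simp add: axis_def if_distrib[of "\<lambda>x. x * _"] cong: if_cong)
    then show "F r \<in> borel_measurable \<mu>" "\<exists>B. \<forall>t\<in>space \<mu>. \<bar>F r t\<bar> \<le> B"
      using diagonal_derivative_bounded[OF x0 D, of "axis r 1"] by auto
  qed
  have X_meas[measurable]: "X r \<in> borel_measurable \<mu>" for r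
    unfolding X_def using F_meas[of r] by measurable
  have F_int: "integrable \<mu> (F r)" for r
  proof -
    obtain B where "\<forall>t\<in>space \<mu>. \<bar>F r t\<bar> \<le> B" using F_bd by blast
    then show ?thesis using F_meas[of r] by (intro integrable_const_bound[where B = B]) auto
  qed
  have cube_int: "integrable \<mu> (\<lambda>t. (a * X i t + b * X j t + c * X l t) ^ 3)"
    and cube_0: "(\<integral>t. (a * X i t + b * X j t + c * X l t) ^ 3 \<partial>\<mu>) = 0" for a b c
  proof -
    have "\<exists>B. \<forall>t\<in>space \<mu>. \<bar>X r t\<bar> \<le> B" for r
    proof -
      obtain B where "\<forall>t\<in>space \<mu>. \<bar>F r t\<bar> \<le> B" using F_bd by blast
      then have "\<forall>t\<in>space \<mu>. \<bar>X r t\<bar> \<le> B + \<bar>\<integral>t. F r t \<partial>\<mu>\<bar>" unfolding X_def by fastforce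
      then show ?thesis by blast
    qed
    then obtain B where B: "\<And>r t. t \<in> space \<mu> \<Longrightarrow> \<bar>X r t\<bar> \<le> B r" by metis
    show "integrable \<mu> (\<lambda>t. (a * X i t + b * X j t + c * X l t) ^ 3)"
    proof (rule integrable_const_bound[where B = "(\<bar>a\<bar> * B i + \<bar>b\<bar> * B j + \<bar>c\<bar> * B l) ^ 3"])
      show "AE t in \<mu>. norm ((a * X i t + b * X j t + c * X l t) ^ 3)
          \<le> (\<bar>a\<bar> * B i + \<bar>b\<bar> * B j + \<bar>c\<bar> * B l) ^ 3"
      proof (rule AE_I2)
        fix t assume t: "t \<in> space \<mu>"
        have "\<bar>a * X i t\<bar> \<le> \<bar>a\<bar> * B i" "\<bar>b * X j t\<bar> \<le> \<bar>b\<bar> * B j" "\<bar>c * X l t\<bar> \<le> \<bar>c\<bar> * B l"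
          unfolding abs_mult by (intro mult_left_mono B[OF t]; simp)+
        then have "\<bar>a * X i t + b * X j t + c * X l t\<bar> \<le> \<bar>a\<bar> * B i + \<bar>b\<bar> * B j + \<bar>c\<bar> * B l"
          by linarith
        then show "norm ((a * X i t + b * X j t + c * X l t) ^ 3) \<le> (\<bar>a\<bar> * B i + \<bar>b\<bar> * B j + \<bar>c\<bar> * B l) ^ 3"
          unfolding real_norm_def power_abs by (intro power_mono) auto
      qed
    qed measurable
    define v :: "real ^ 'n" where "v = a *\<^sub>R axis i 1 + b *\<^sub>R axis j 1 + c *\<^sub>R axis l 1"
    have "(\<Sum>r\<in>UNIV. v $ r * F r t) = a * F i t + b * F j t + c * F l t" for t
      by (simp add: v_def axis_def distrib_right sum.distrib if_distrib[of "\<lambda>x. _ * x * _"] if_distrib[of "\<lambda>x. x * _"] cong: if_cong)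
    then have "(\<integral>t. ((a * F i t + b * F j t + c * F l t)
        - (\<integral>t. a * F i t + b * F j t + c * F l t \<partial>\<mu>)) ^ 3 \<partial>\<mu>) = 0"
      using no D[of _ v] unfolding skew_at_def by force
    moreover have "(\<integral>t. a * F i t + b * F j t + c * F l t \<partial>\<mu>)
        = a * (\<integral>t. F i t \<partial>\<mu>) + b * (\<integral>t. F j t \<partial>\<mu>) + c * (\<integral>t. F l t \<partial>\<mu>)"
      using F_int by simp
    ultimately show "(\<integral>t. (a * X i t + b * X j t + c * X l t) ^ 3 \<partial>\<mu>) = 0"
      by (simp add: X_def algebra_simps)
  qed
  have "24 * (X i t * X j t * X l t) = (1 * X i t + 1 * X j t + 1 * X l t) ^ 3
      - (1 * X i t + 1 * X j t + (- 1) * X l t) ^ 3 - (1 * X i t + (- 1) * X j t + 1 * X l t) ^ 3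
      - ((- 1) * X i t + 1 * X j t + 1 * X l t) ^ 3" for t
    by (simp add: power3_eq_cube algebra_simps)
  then have "(\<integral>t. 24 * (X i t * X j t * X l t) \<partial>\<mu>) = 0"
    using cube_int cube_0 by (simp only: Bochner_Integration.integral_diff Bochner_Integration.integrable_diff)
  then have "(\<integral>t. X i t * X j t * X l t \<partial>\<mu>) = 0" by simp
  then show False using nz by (simp add: avg_def centered_partial_def X_def F_def)
qed

section \<open>Gini pairs and the Euler equation\<close>

lemma DERIV_powr_divide:
  fixes x :: real
  assumes "x > 0"
  shows "((\<lambda>x. x powr a) has_real_derivative a * x powr a / x) (at x)"
  using assms by (auto intro!: derivative_eq_intros simp: powr_diff)

text \<open>
  The exponents are the roots of the indicial equation \<open>r\<^sup>2 - (1 + \<alpha>) r - \<beta> = 0\<close>. Its discriminant \<open>\<Delta>\<close>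
  decides between the three kinds of Gini pairs: powers, a power with a logarithm, and a power with
  trigonometric functions of the logarithm.
\<close>

lemma euler_equation_gini_solutions:
  fixes \<alpha> \<beta> :: real
  obtains p q F G where "p + q \<in> \<real>" "p * q \<in> \<real>"
    "\<And>x. x > 0 \<Longrightarrow> (gini_f p q has_real_derivative F x) (at x)"
    "\<And>x. x > 0 \<Longrightarrow> (F has_real_derivative \<alpha> / x * F x + \<beta> / x\<^sup>2 * gini_f p q x) (at x)"
    "\<And>x. x > 0 \<Longrightarrow> (gini_g p q has_real_derivative G x) (at x)"
    "\<And>x. x > 0 \<Longrightarrow> (G has_real_derivative \<alpha> / x * G x + \<beta> / x\<^sup>2 * gini_g p q x) (at x)"
    "\<And>x. x > 0 \<Longrightarrow> F x * gini_g p q x - gini_f p q x * G x \<noteq> 0"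
proof -
  note d = DERIV_powr_divide
  define \<Delta> where "\<Delta> = (1 + \<alpha>)\<^sup>2 + 4 * \<beta>"
  consider "\<Delta> > 0" | "\<Delta> = 0" | "\<Delta> < 0" by linarith
  then show ?thesis
  proof cases
    case 1
    define P Q where "P = ((1 + \<alpha>) + sqrt \<Delta>) / 2" and "Q = ((1 + \<alpha>) - sqrt \<Delta>) / 2"
    have PQ: "\<alpha> = P + Q - 1" 
proof -
      have "2 * P = 1 + \<alpha> + sqrt \<Delta>" "2 * Q = 1 + \<alpha> - sqrt \<Delta>" by (simp_all add: P_def Q_def)
      then show ?thesis by linarith
    qed
    have "P * Q = ((1 + \<alpha>)\<^sup>2 - (sqrt \<Delta>)\<^sup>2) / 4"
      by (simp add: P_def Q_def field_simps power2_eq_square)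
    then have \<beta>: "\<beta> = - (P * Q)" using 1 by (simp add: \<Delta>_def)
    have ne: "P \<noteq> Q" using 1 by (simp add: P_def Q_def)
    have f: "gini_f (of_real P) (of_real Q) = (\<lambda>x. x powr P)"
      and g: "gini_g (of_real P) (of_real Q) = (\<lambda>x. x powr Q)"
      using ne by (auto simp: gini_f_def gini_g_def)
    show ?thesis
    proof (rule that[of "of_real P" "of_real Q" "\<lambda>x. P * x powr P / x" "\<lambda>x. Q * x powr Q / x"])
      fix x :: real assume x: "x > 0"
      show "(gini_f (of_real P) (of_real Q) has_real_derivative P * x powr P / x) (at x)"
        "(gini_g (of_real P) (of_real Q) has_real_derivative Q * x powr Q / x) (at x)"
        unfolding f g by (rule d[OF x])+
      show "((\<lambda>x. P * x powr P / x) has_real_derivative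
          \<alpha> / x * (P * x powr P / x) + \<beta> / x\<^sup>2 * gini_f (of_real P) (of_real Q) x) (at x)"
        "((\<lambda>x. Q * x powr Q / x) has_real_derivative
          \<alpha> / x * (Q * x powr Q / x) + \<beta> / x\<^sup>2 * gini_g (of_real P) (of_real Q) x) (at x)"
        unfolding f g PQ \<beta>
        by (rule derivative_eq_intros d[OF x] refl | use x in \<open>simp add: field_simps power2_eq_square; fail\<close>)+
      have "P * x powr P / x * x powr Q - x powr P * (Q * x powr Q / x) = (P - Q) * x powr P * x powr Q / x"
        using x by (simp add: field_simps)
      then show "P * x powr P / x * gini_g (of_real P) (of_real Q) x
          - gini_f (of_real P) (of_real Q) x * (Q * x powr Q / x) \<noteq> 0"
        unfolding f g using ne x by simp
    qed (simp_all flip: of_real_add of_real_mult)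
  next
    case 2
    define P where "P = (1 + \<alpha>) / 2"
    have "2 * P = 1 + \<alpha>" unfolding P_def by simp
    then have \<alpha>: "\<alpha> = 2 * P - 1" by linarith
    have \<beta>: "\<beta> = - (P * P)" using 2 by (simp add: \<Delta>_def P_def power2_eq_square field_simps)
    have f: "gini_f (of_real P) (of_real P) = (\<lambda>x. x powr P * ln x)"
      and g: "gini_g (of_real P) (of_real P) = (\<lambda>x. x powr P)"
      by (auto simp: gini_f_def gini_g_def)
    show ?thesis
    proof (rule that[of "of_real P" "of_real P" "\<lambda>x. (P * (x powr P * ln x) + x powr P) / x" "\<lambda>x. P * x powr P / x"])
      fix x :: real assume x: "x > 0"
      show "(gini_f (of_real P) (of_real P) has_real_derivative (P * (x powr P * ln x) + x powr P) / x) (at x)"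
        unfolding f
        by (rule derivative_eq_intros d[OF x] refl | use x in \<open>simp add: field_simps; fail\<close>)+
      show "(gini_g (of_real P) (of_real P) has_real_derivative P * x powr P / x) (at x)"
        unfolding g by (rule d[OF x])
      show "((\<lambda>x. (P * (x powr P * ln x) + x powr P) / x) has_real_derivative
          \<alpha> / x * ((P * (x powr P * ln x) + x powr P) / x) + \<beta> / x\<^sup>2 * gini_f (of_real P) (of_real P) x) (at x)"
        unfolding f \<alpha> \<beta>
        by (rule derivative_eq_intros d[OF x] refl | use x in \<open>simp add: field_simps power2_eq_square; fail\<close>)+
      show "((\<lambda>x. P * x powr P / x) has_real_derivative
          \<alpha> / x * (P * x powr P / x) + \<beta> / x\<^sup>2 * gini_g (of_real P) (of_real P) x) (at x)"
        unfolding g \<alpha> \<beta>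
        by (rule derivative_eq_intros d[OF x] refl | use x in \<open>simp add: field_simps power2_eq_square; fail\<close>)+
      have "(P * (x powr P * ln x) + x powr P) / x * x powr P - x powr P * ln x * (P * x powr P / x)
          = x powr P * x powr P / x"
        using x by (simp add: field_simps)
      then show "(P * (x powr P * ln x) + x powr P) / x * gini_g (of_real P) (of_real P) x
          - gini_f (of_real P) (of_real P) x * (P * x powr P / x) \<noteq> 0"
        unfolding f g using x by simp
    qed (simp_all flip: of_real_add of_real_mult)
  next
    case 3
    define a b where "a = (1 + \<alpha>) / 2" and "b = sqrt (- \<Delta>) / 2"
    have "2 * a = 1 + \<alpha>" unfolding a_def by simp
    then have \<alpha>: "\<alpha> = 2 * a - 1" by linarith
    have "b * b = - \<Delta> / 4" using 3 by (simp add: b_def)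
    then have \<beta>: "\<beta> = - (a * a + b * b)" by (simp add: \<Delta>_def a_def power2_eq_square field_simps)
    have b: "b \<noteq> 0" using 3 by (simp add: b_def)
    have f: "gini_f (Complex a b) (Complex a (- b)) = (\<lambda>x. x powr a * sin (b * ln x))"
      and g: "gini_g (Complex a b) (Complex a (- b)) = (\<lambda>x. x powr a * cos (b * ln x))"
      using b by (auto simp: gini_f_def gini_g_def complex_is_Real_iff)
    show ?thesis
    proof (rule that[of "Complex a b" "Complex a (- b)"
          "\<lambda>x. (a * (x powr a * sin (b * ln x)) + b * (x powr a * cos (b * ln x))) / x"
          "\<lambda>x. (a * (x powr a * cos (b * ln x)) - b * (x powr a * sin (b * ln x))) / x"])
      fix x :: real assume x: "x > 0"
      show "(gini_f (Complex a b) (Complex a (- b)) has_real_derivative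
          (a * (x powr a * sin (b * ln x)) + b * (x powr a * cos (b * ln x))) / x) (at x)"
        "(gini_g (Complex a b) (Complex a (- b)) has_real_derivative
          (a * (x powr a * cos (b * ln x)) - b * (x powr a * sin (b * ln x))) / x) (at x)"
        unfolding f g
        by (rule derivative_eq_intros d[OF x] refl | use x in \<open>simp add: field_simps; fail\<close>)+
      show "((\<lambda>x. (a * (x powr a * sin (b * ln x)) + b * (x powr a * cos (b * ln x))) / x) has_real_derivative
          \<alpha> / x * ((a * (x powr a * sin (b * ln x)) + b * (x powr a * cos (b * ln x))) / x)
          + \<beta> / x\<^sup>2 * gini_f (Complex a b) (Complex a (- b)) x) (at x)"
        "((\<lambda>x. (a * (x powr a * cos (b * ln x)) - b * (x powr a * sin (b * ln x))) / x) has_real_derivative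
          \<alpha> / x * ((a * (x powr a * cos (b * ln x)) - b * (x powr a * sin (b * ln x))) / x)
          + \<beta> / x\<^sup>2 * gini_g (Complex a b) (Complex a (- b)) x) (at x)"
        unfolding f g \<alpha> \<beta>
        by (rule derivative_eq_intros d[OF x] refl | use x in \<open>simp add: field_simps power2_eq_square; fail\<close>)+
      have "(a * (x powr a * sin (b * ln x)) + b * (x powr a * cos (b * ln x))) / x * (x powr a * cos (b * ln x))
          - x powr a * sin (b * ln x) * ((a * (x powr a * cos (b * ln x)) - b * (x powr a * sin (b * ln x))) / x)
          = b * x powr a * x powr a * ((sin (b * ln x))\<^sup>2 + (cos (b * ln x))\<^sup>2) / x"
        using x by (simp add: field_simps power2_eq_square del: sin_cos_squared_add sin_cos_squared_add2 sin_cos_squared_add3)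
      then show "(a * (x powr a * sin (b * ln x)) + b * (x powr a * cos (b * ln x))) / x
            * gini_g (Complex a b) (Complex a (- b)) x
          - gini_f (Complex a b) (Complex a (- b)) x
            * ((a * (x powr a * cos (b * ln x)) - b * (x powr a * sin (b * ln x))) / x) \<noteq> 0"
        unfolding f g using x b by simp
    qed (simp_all add: complex_is_Real_iff)
  qed
qed

text \<open>
  The determinant of a Gini pair is homogeneous, of degree \<open>Re p + Re q\<close> for real exponents and \<open>2 Re p\<close>
  otherwise: logarithms enter only through \<open>ln u - ln v\<close>.
\<close>

lemma gini_cheb_det_rescale:
  assumes c: "c > 0"
  shows "\<exists>K. K \<noteq> 0 \<and> (\<forall>u>0. \<forall>v>0. cheb_det (gini_f p q) (gini_g p q) u v
    = K * cheb_det (rescale c (gini_f p q)) (rescale c (gini_g p q)) u v)"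
proof -
  consider "p \<in> \<real>" "q \<in> \<real>" "p \<noteq> q" | "p \<in> \<real>" "q \<in> \<real>" "p = q" | "\<not> (p \<in> \<real> \<and> q \<in> \<real>)" by blast
  then show ?thesis
  proof cases
    case 1
    let ?K = "1 / (c powr Re p * c powr Re q)"
    show ?thesis
      using c 1 by (intro exI[of _ ?K]) (auto simp: cheb_det_def rescale_def gini_f_def gini_g_def powr_mult field_simps)
  next
    case 2
    let ?K = "1 / (c powr Re p * c powr Re p)"
    show ?thesis
      using c 2 by (intro exI[of _ ?K]) (auto simp: cheb_det_def rescale_def gini_f_def gini_g_def powr_mult ln_mult field_simps)
  next
    case 3
    let ?K = "1 / (c powr Re p * c powr Re p)"
    have det: "cheb_det (gini_f p q) (gini_g p q) u v = u powr Re p * v powr Re p * sin (Im p * (ln u - ln v))" for u v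
      using 3 by (auto simp: cheb_det_def gini_f_def gini_g_def right_diff_distrib sin_diff algebra_simps)
    have "cheb_det (rescale c (gini_f p q)) (rescale c (gini_g p q)) u v
        = cheb_det (gini_f p q) (gini_g p q) (c * u) (c * v)" for u v
      by (simp add: cheb_det_def rescale_def)
    then show ?thesis
      using c unfolding det by (intro exI[of _ ?K]) (auto simp: powr_mult ln_mult)
  qed
qed

section \<open>Characterizations of homogeneity\<close>

theorem theorem5p2:
  fixes I :: "real set"
    and f g :: "real \<Rightarrow> real"
    and m :: "real ^ 'n::finite \<Rightarrow> 't \<Rightarrow> real"
    and \<mu> :: "'t measure"
  assumes I: "I \<noteq> {}" "open I" "is_interval I" "I \<subseteq> {0<..}"
    and fg: "smooth_chebyshev 3 I f g"
    and m: "C3_family I \<mu> m" "homogeneous_family I \<mu> m"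
    and \<mu>: "prob_space \<mu>"
    and x0: "\<exists>x0 \<in> I.
      measure \<mu> {t \<in> space \<mu>. \<forall>r. centered_partial \<mu> r m (vec x0) t = 0} < 1 \<and>
      (\<exists>i j l. avg \<mu> (\<lambda>x t. centered_partial \<mu> i m x t * centered_partial \<mu> j m x t
                              * centered_partial \<mu> l m x t) (vec x0) \<noteq> 0)"
  shows
    "(homogeneous_on I (gen_mean I f g m \<mu>) \<longleftrightarrow>
      (\<forall>c \<in> ratio_set I. \<forall>x \<in> cube (scaled_inter I c).
        gen_mean I f g m \<mu> x
          = gen_mean (scaled_inter I c) (rescale c f) (rescale c g) m \<mu> x)) \<and>
     (homogeneous_on I (gen_mean I f g m \<mu>) \<longleftrightarrow>
      (\<forall>c \<in> ratio_set I.
        equivalent_pairs (scaled_inter I c) (f, g) (rescale c f, rescale c g))) \<and>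
     (homogeneous_on I (gen_mean I f g m \<mu>) \<longleftrightarrow>
      (\<forall>c \<in> ratio_set I. \<forall>x \<in> scaled_inter I c.
        Phi f g x = Phi (rescale c f) (rescale c g) x \<and>
        Psi f g x = Psi (rescale c f) (rescale c g) x)) \<and>
     (homogeneous_on I (gen_mean I f g m \<mu>) \<longleftrightarrow>
      (\<exists>\<alpha> \<beta> :: real. \<forall>y \<in> {f, g}. \<forall>x \<in> I.
        deriv (deriv y) x = \<alpha> / x * deriv y x + \<beta> / x\<^sup>2 * y x)) \<and>
     (homogeneous_on I (gen_mean I f g m \<mu>) \<longleftrightarrow>
      (\<exists>p q :: complex. p + q \<in> \<real> \<and> p * q \<in> \<real> \<and> gini_mean_defined I p q \<and>
        (\<forall>x \<in> cube I. gen_mean I f g m \<mu> x = gini_mean I p q m \<mu> x)))"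
    (is "(?i \<longleftrightarrow> ?ii) \<and> (?i \<longleftrightarrow> ?iii) \<and> (?i \<longleftrightarrow> ?iv) \<and> (?i \<longleftrightarrow> ?v) \<and> (?i \<longleftrightarrow> ?vi)")
proof -
  have C1: "C1_family I \<mu> m" using m(1) by (simp add: C3_family_def C2_family_def)
  interpret interval_means \<mu> I m
    using \<mu> I C1 by (simp add: interval_means_def interval_means_axioms_def C1_family_def)
  note cheb = smooth_chebyshev_imp_chebyshev[OF fg]
  have skew: "skew_at \<mu> m x" if "x \<in> I" for x
    using x0 third_central_moment_imp_skew_at[OF C1] skew_at_homogeneous[OF I(4) m(2) _ that] by blast
  have pos: "c > 0" if "c \<in> ratio_set I" for c by (rule ratio_set_pos[OF I(4) that])
  have J: "open (scaled_inter I c)" "is_interval (scaled_inter I c)" "scaled_inter I c \<subseteq> I"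
    "scaled_inter I c \<noteq> {}" if c: "c \<in> ratio_set I" for c
  proof -
    obtain a b where ab: "a \<in> I" "b \<in> I" "c = a / b" using c by (auto simp: ratio_set_def)
    then have "c * b = a" using I(4) by auto
    then have "b \<in> scaled_inter I c" using ab(1,2) by (simp add: scaled_inter_iff[OF pos[OF c]])
    then show "scaled_inter I c \<noteq> {}" by blast
  qed (use open_scaled_inter[OF pos[OF c] I(2)] is_interval_scaled_inter[OF pos[OF c] I(3)]
      scaled_inter_subset in auto)
  have fg_sub: "smooth_chebyshev 3 (scaled_inter I c) f g" if "c \<in> ratio_set I" for c
    by (rule smooth_chebyshev_subset[OF fg J(3)[OF that]])
  have fg_resc: "smooth_chebyshev 3 (scaled_inter I c) (rescale c f) (rescale c g)"
    if "c \<in> ratio_set I" for c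
    by (rule smooth_chebyshev_rescale[OF pos[OF that] I(2) fg]) simp
  have i_ii: "?i \<longleftrightarrow> ?ii" by (rule homogeneous_iff_rescale[OF I(4) m(2) cheb])
  have ii_iv: "?iv" if ?ii
  proof (intro ballI)
    fix c x assume c: "c \<in> ratio_set I" and x: "x \<in> scaled_inter I c"
    interpret J: interval_means \<mu> "scaled_inter I c" m
      by (rule subinterval_means[OF J(1-3)[OF c]])
    have "gen_mean (scaled_inter I c) f g m \<mu> z
        = gen_mean (scaled_inter I c) (rescale c f) (rescale c g) m \<mu> z"
      if "z \<in> cube (scaled_inter I c)" for z
      using gen_mean_subinterval[OF J(1-3)[OF c] cheb that] \<open>?ii\<close> c that by simp
    from J.same_means_imp_same_invariants[OF fg_sub[OF c] fg_resc[OF c] this _ x] skew J(3)[OF c]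
    show "Phi f g x = Phi (rescale c f) (rescale c g) x \<and> Psi f g x = Psi (rescale c f) (rescale c g) x"
      by blast
  qed
  have iv_iii: "?iii" if ?iv
  proof
    fix c assume c: "c \<in> ratio_set I"
    show "equivalent_pairs (scaled_inter I c) (f, g) (rescale c f, rescale c g)"
      by (rule same_invariants_imp_equivalent[OF J(1,2,4)[OF c] fg_sub[OF c] fg_resc[OF c]])
        (use that c in auto)
  qed
  have iii_i: "?i" if ?iii
  proof (rule proportional_rescaling_imp_homogeneous[OF I(4) m(2) cheb])
    fix c assume c: "c \<in> ratio_set I"
    with that show "\<exists>K. K \<noteq> 0 \<and> (\<forall>u\<in>scaled_inter I c. \<forall>v\<in>scaled_inter I c.
        cheb_det f g u v = K * cheb_det (rescale c f) (rescale c g) u v)"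
      by (meson equivalent_pairs_cheb_det)
  qed
  have iv_v: "?v" if iv: ?iv
  proof -
    obtain z where z: "z \<in> I" using I(1) by blast
    have inv: "Phi f g x = z * Phi f g z / x" "Psi f g x = z\<^sup>2 * Psi f g z / x\<^sup>2" if x: "x \<in> I" for x
    proof -
      \<comment> \<open>With this ratio every point is compared with \<open>z\<close>: \<open>x \<Phi>(x)\<close> and \<open>x\<^sup>2 \<Psi>(x)\<close> are constant.\<close>
      define c where "c = z / x"
      have c: "c \<in> ratio_set I" unfolding c_def ratio_set_def using x z by blast
      have cx: "c * x = z" using x I(4) by (auto simp: c_def)
      have xJ: "x \<in> scaled_inter I c" using x z by (simp add: scaled_inter_iff[OF pos[OF c]] cx)
      have "Phi f g x = c * Phi f g z" "Psi f g x = c\<^sup>2 * Psi f g z"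
        using iv c xJ Phi_rescale[OF pos[OF c] I(2) fg _ xJ] Psi_rescale[OF pos[OF c] I(2) fg _ xJ]
        by (simp_all add: cx)
      then show "Phi f g x = z * Phi f g z / x" "Psi f g x = z\<^sup>2 * Psi f g z / x\<^sup>2"
        by (simp_all add: c_def power_divide)
    qed
    show ?thesis
      using solves_own_ode[OF smooth_chebyshev_wronskian[OF fg]] inv
      by (intro exI[of _ "z * Phi f g z"] exI[of _ "z\<^sup>2 * Psi f g z"]) auto
  qed
  have v_iv: "?iv" if ?v
  proof -
    from that obtain \<alpha> \<beta> where
      ode: "\<And>x. x \<in> I \<Longrightarrow> deriv (deriv f) x = \<alpha> / x * deriv f x + \<beta> / x\<^sup>2 * f x"
      "\<And>x. x \<in> I \<Longrightarrow> deriv (deriv g) x = \<alpha> / x * deriv g x + \<beta> / x\<^sup>2 * g x"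
      by auto
    have inv: "Phi f g x = \<alpha> / x" "Psi f g x = \<beta> / x\<^sup>2" if "x \<in> I" for x
      by (rule ode_determines_invariants[OF smooth_chebyshev_wronskian[OF fg that] ode[OF that]])+
    show ?thesis
    proof (intro ballI)
      fix c x assume c: "c \<in> ratio_set I" and x: "x \<in> scaled_inter I c"
      have "x \<in> I" "c * x \<in> I" using x by (simp_all add: scaled_inter_iff[OF pos[OF c]])
      then show "Phi f g x = Phi (rescale c f) (rescale c g) x \<and> Psi f g x = Psi (rescale c f) (rescale c g) x"
        using Phi_rescale[OF pos[OF c] I(2) fg _ x] Psi_rescale[OF pos[OF c] I(2) fg _ x] pos[OF c]
        by (simp add: inv power_mult_distrib)
    qed
  qed
  have v_vi: "?vi" if ?v
  proof -
    from that obtain \<alpha> \<beta> where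
      ode: "\<And>x. x \<in> I \<Longrightarrow> deriv (deriv f) x = \<alpha> / x * deriv f x + \<beta> / x\<^sup>2 * f x"
      "\<And>x. x \<in> I \<Longrightarrow> deriv (deriv g) x = \<alpha> / x * deriv g x + \<beta> / x\<^sup>2 * g x"
      by auto
    obtain p q F G where pq: "p + q \<in> \<real>" "p * q \<in> \<real>"
      and gini: "\<And>x. x > 0 \<Longrightarrow> (gini_f p q has_real_derivative F x) (at x)"
      "\<And>x. x > 0 \<Longrightarrow> (F has_real_derivative \<alpha> / x * F x + \<beta> / x\<^sup>2 * gini_f p q x) (at x)"
      "\<And>x. x > 0 \<Longrightarrow> (gini_g p q has_real_derivative G x) (at x)"
      "\<And>x. x > 0 \<Longrightarrow> (G has_real_derivative \<alpha> / x * G x + \<beta> / x\<^sup>2 * gini_g p q x) (at x)"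
      "\<And>x. x > 0 \<Longrightarrow> F x * gini_g p q x - gini_f p q x * G x \<noteq> 0"
      using euler_equation_gini_solutions[of \<alpha> \<beta>] by metis
    have "equivalent_pairs I (f, g) (gini_f p q, gini_g p q)"
      by (rule ode_solutions_equivalent[OF I(2,3,1) fg _ ode gini]) (use I(4) in auto)
    then obtain K where K: "K \<noteq> 0" "\<And>u v. u \<in> I \<Longrightarrow> v \<in> I \<Longrightarrow>
        cheb_det f g u v = K * cheb_det (gini_f p q) (gini_g p q) u v"
      by (rule equivalent_pairs_cheb_det) blast
    have "continuous_on I (gini_f p q)" "continuous_on I (gini_g p q)"
      using I(4) by (auto intro!: continuous_at_imp_continuous_on DERIV_isCont[OF gini(1)] DERIV_isCont[OF gini(3)])
    moreover have "cheb_det (gini_f p q) (gini_g p q) u v \<noteq> 0" if "u \<in> I" "v \<in> I" "u \<noteq> v" for u v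
    proof -
      have "cheb_det f g u v \<noteq> 0" using cheb that unfolding chebyshev_system_def by blast
      then show ?thesis using K(2)[OF that(1,2)] by simp
    qed
    ultimately have "gini_mean_defined I p q"
      unfolding gini_mean_defined_def chebyshev_system_def by blast
    then show ?thesis
      using pq gen_mean_cong_proportional[OF K] unfolding gini_mean_def by blast
  qed
  have vi_i: "?i" if ?vi
  proof -
    from that obtain p q where def: "gini_mean_defined I p q"
      and eq: "\<And>x. x \<in> cube I \<Longrightarrow> gen_mean I f g m \<mu> x = gini_mean I p q m \<mu> x"
      by blast
    have "homogeneous_on I (gini_mean I p q m \<mu>)"
      unfolding gini_mean_def
    proof (rule proportional_rescaling_imp_homogeneous[OF I(4) m(2) def[unfolded gini_mean_defined_def]])
      fix c assume c: "c \<in> ratio_set I"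
      have "u > 0" if "u \<in> scaled_inter I c" for u using that J(3)[OF c] I(4) by auto
      then show "\<exists>K. K \<noteq> 0 \<and> (\<forall>u\<in>scaled_inter I c. \<forall>v\<in>scaled_inter I c.
          cheb_det (gini_f p q) (gini_g p q) u v
            = K * cheb_det (rescale c (gini_f p q)) (rescale c (gini_g p q)) u v)"
        using gini_cheb_det_rescale[OF pos[OF c], of p q] by blast
    qed
    moreover have "x \<in> cube I" "c *\<^sub>R x \<in> cube I"
      if "c \<in> ratio_set I" "x \<in> cube (scaled_inter I c)" for c and x :: "real ^ 'n"
      using that(2) by (auto simp: cube_def scaled_inter_iff[OF pos[OF that(1)]])
    ultimately show ?thesis unfolding homogeneous_on_def by (simp add: eq)
  qed
  show ?thesis
    using i_ii ii_iv iv_iii iii_i iv_v v_iv v_vi vi_i by blast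
qed

end
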